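(* Assume there exists an integer $q\ge1$ such that $\sigma(q)<(\gamma b)^q$. Then $\vartheta$ is absolutely continuous with respect to Lebesgue measure on $\mathbb{R}/\mathbb{Z}\times\mathbb{R}$ with square integrable density; in particular, for Lebesgue a.e. $x\in[0,1)$, $m_x$ is absolutely continuous with respect to Lebesgue measure on $\mathbb{R}$ with square integrable density.
   Context: Standing setup: $b\ge2$ is an integer, $\mathcal{A}=\{0,\dots,b-1\}$, $\gamma\in(1/b,1)$, $\psi:\mathbb{R}\to\mathbb{R}$ is a $\mathbb{Z}$-periodic $C^1$ function, $\mathbb{P}$ is the uniform Bernoulli measure on $\mathcal{A}^{\mathbb{Z}^+}$. For $x\in\mathbb{R}$, $\mathbf{i}\in\mathcal{A}^{\mathbb{Z}^+}$: $S(x,\mathbf{i})=\sum_{n\ge1}\gamma^{n-1}\psi\big(\frac{x+i_1+i_2b+\cdots+i_nb^{n-1}}{b^n}\big)$, and $S'(x,\mathbf{i})=\partial_xS(x,\mathbf{i})$. $m_x$ is the push-forward of $\mathbb{P}$ under $\mathbf{i}\mapsto S(x,\mathbf{i})$, and $\vartheta(B)=\int_0^1m_x(B_x)dx$ on $\mathbb{R}/\mathbb{Z}\times\mathbb{R}\cong[0,1)\times\mathbb{R}$, $B_x=\{y:(x,y)\in B\}$ (the SRB measure of $T(x,y)=(bx\bmod1,\gamma y+\psi(x))$). For $x\in\mathbb{R}$ and $\mathbf{u}=(u_1,\dots,u_q)\in\mathcal{A}^q$ put $x(\mathbf{u})=\frac{x+u_1+u_2b+\cdots+u_qb^{q-1}}{b^q}$.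 For $\mathbf{k}\in\mathcal{A}^q$, $\mathbf{u}\in\mathcal{A}^{\mathbb{Z}^+}$, $\mathbf{ku}$ denotes concatenation. Two sequences $\mathbf{i},\mathbf{j}\in\mathcal{A}^{\mathbb{Z}^+}$ are $(\varepsilon,\delta)$-tangent at $x_0$ if $|S(x_0,\mathbf{i})-S(x_0,\mathbf{j})|\le\varepsilon$ and $|S'(x_0,\mathbf{i})-S'(x_0,\mathbf{j})|\le\delta$. $E(q,x_0;\varepsilon,\delta)$ is the set of $(\mathbf{k},\mathbf{l})\in\mathcal{A}^q\times\mathcal{A}^q$ for which there are $\mathbf{u},\mathbf{v}\in\mathcal{A}^{\mathbb{Z}^+}$ with $\mathbf{ku},\mathbf{lv}$ $(\varepsilon,\delta)$-tangent at $x_0$. A weight function is a measurable $\omega:[0,1)\to(0,\infty)$ with $\|\omega\|_\infty,\|1/\omega\|_\infty<\infty$. A testing function of order $q$ is a measurable $V:[0,1)\times\mathcal{A}^q\times\mathcal{A}^q\to[0,\infty)$; it is admissible if there exist $\varepsilon,\delta>0$ such that for all $x\in[0,1)$ and $(\mathbf{u},\mathbf{v})\in E(q,x;\varepsilon,\delta)$, $V(x,\mathbf{u},\mathbf{v})V(x,\mathbf{v},\mathbf{u})\ge1$. Put $\Sigma_{V,\omega}(x)=\sup_{\mathbf{u}\in\mathcal{A}^q}\frac{\omega(x)}{\omega(x(\mathbf{u}))}\sum_{\mathbf{v}\in\mathcal{A}^q}V(x,\mathbf{u},\mathbf{v})$ and $\sigma(q)=\inf\|\Sigma_{V,\omega}\|_\infty$,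 the infimum over all weight functions $\omega$ and admissible testing functions $V$ of order $q$. *)

theory Defs
  imports "HOL-Probability.Probability"
begin

text \<open>Sequences in A^{Z+} are functions nat => nat with values < b; the paper's
  i_1, i_2, ... are i 0, i 1, ....  Finite words u in A^q are lists of length q
  with entries < b, u_1 = u!0.\<close>

definition seqs :: "nat \<Rightarrow> (nat \<Rightarrow> nat) set" where
  "seqs b = {i. \<forall>n. i n < b}"

definition words :: "nat \<Rightarrow> nat \<Rightarrow> nat list set" where
  "words b q = {u. length u = q \<and> (\<forall>a\<in>set u. a < b)}"

definition S :: "nat \<Rightarrow> real \<Rightarrow> (real \<Rightarrow> real) \<Rightarrow> real \<Rightarrow> (nat \<Rightarrow> nat) \<Rightarrow> real" where
  "S b \<gamma> \<psi> x i = (\<Sum>n. \<gamma> ^ n * \<psi> ((x + (\<Sum>k<Suc n. real (i k) * real b ^ k)) / real b ^ Suc n))"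

definition S' :: "nat \<Rightarrow> real \<Rightarrow> (real \<Rightarrow> real) \<Rightarrow> real \<Rightarrow> (nat \<Rightarrow> nat) \<Rightarrow> real" where
  "S' b \<gamma> \<psi> x i = deriv (\<lambda>t. S b \<gamma> \<psi> t i) x"

definition bernoulli :: "nat \<Rightarrow> (nat \<Rightarrow> nat) measure" where
  "bernoulli b = PiM UNIV (\<lambda>_. measure_pmf (pmf_of_set {0..<b}))"

definition mx :: "nat \<Rightarrow> real \<Rightarrow> (real \<Rightarrow> real) \<Rightarrow> real \<Rightarrow> real measure" where
  "mx b \<gamma> \<psi> x = distr (bernoulli b) borel (\<lambda>i. S b \<gamma> \<psi> x i)"

definition vartheta :: "nat \<Rightarrow> real \<Rightarrow> (real \<Rightarrow> real) \<Rightarrow> (real \<times> real) set \<Rightarrow> ennreal" where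
  "vartheta b \<gamma> \<psi> B = (\<integral>\<^sup>+ x \<in> {0..<1}. emeasure (mx b \<gamma> \<psi> x) {y. (x, y) \<in> B} \<partial>lborel)"

definition xw :: "nat \<Rightarrow> real \<Rightarrow> nat list \<Rightarrow> real" where
  "xw b x u = (x + (\<Sum>k<length u. real (u ! k) * real b ^ k)) / real b ^ length u"

definition concat_seq :: "nat list \<Rightarrow> (nat \<Rightarrow> nat) \<Rightarrow> nat \<Rightarrow> nat" where
  "concat_seq k u = (\<lambda>n. if n < length k then k ! n else u (n - length k))"

definition tangent :: "nat \<Rightarrow> real \<Rightarrow> (real \<Rightarrow> real) \<Rightarrow> real \<Rightarrow> real \<Rightarrow> real
    \<Rightarrow> (nat \<Rightarrow> nat) \<Rightarrow> (nat \<Rightarrow> nat) \<Rightarrow> bool" where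
  "tangent b \<gamma> \<psi> \<epsilon> \<delta> x0 i j \<longleftrightarrow>
     \<bar>S b \<gamma> \<psi> x0 i - S b \<gamma> \<psi> x0 j\<bar> \<le> \<epsilon> \<and> \<bar>S' b \<gamma> \<psi> x0 i - S' b \<gamma> \<psi> x0 j\<bar> \<le> \<delta>"

definition Eset :: "nat \<Rightarrow> real \<Rightarrow> (real \<Rightarrow> real) \<Rightarrow> nat \<Rightarrow> real \<Rightarrow> real \<Rightarrow> real
    \<Rightarrow> (nat list \<times> nat list) set" where
  "Eset b \<gamma> \<psi> q x0 \<epsilon> \<delta> = {(k, l). k \<in> words b q \<and> l \<in> words b q \<and>
     (\<exists>u\<in>seqs b. \<exists>v\<in>seqs b. tangent b \<gamma> \<psi> \<epsilon> \<delta> x0 (concat_seq k u) (concat_seq l v))}"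

definition leb01 :: "real measure" where
  "leb01 = restrict_space lborel {0..<1}"

definition Linf_norm :: "(real \<Rightarrow> real) \<Rightarrow> ereal" where
  "Linf_norm f = esssup leb01 (\<lambda>x. ereal \<bar>f x\<bar>)"

definition weight_function :: "(real \<Rightarrow> real) \<Rightarrow> bool" where
  "weight_function \<omega> \<longleftrightarrow> \<omega> \<in> borel_measurable leb01 \<and> (\<forall>x\<in>{0..<1}. \<omega> x > 0)
     \<and> Linf_norm \<omega> < \<infinity> \<and> Linf_norm (\<lambda>x. 1 / \<omega> x) < \<infinity>"

definition testing_function :: "nat \<Rightarrow> nat \<Rightarrow> (real \<Rightarrow> nat list \<Rightarrow> nat list \<Rightarrow> real) \<Rightarrow> bool" where
  "testing_function b q V \<longleftrightarrow>
     (\<forall>u\<in>words b q. \<forall>v\<in>words b q. (\<lambda>x. V x u v) \<in> borel_measurable leb01) \<and>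
     (\<forall>x\<in>{0..<1}. \<forall>u\<in>words b q. \<forall>v\<in>words b q. V x u v \<ge> 0)"

definition admissible :: "nat \<Rightarrow> real \<Rightarrow> (real \<Rightarrow> real) \<Rightarrow> nat
    \<Rightarrow> (real \<Rightarrow> nat list \<Rightarrow> nat list \<Rightarrow> real) \<Rightarrow> bool" where
  "admissible b \<gamma> \<psi> q V \<longleftrightarrow> testing_function b q V \<and>
     (\<exists>\<epsilon>>0. \<exists>\<delta>>0. \<forall>x\<in>{0..<1}. \<forall>(u, v)\<in>Eset b \<gamma> \<psi> q x \<epsilon> \<delta>. V x u v * V x v u \<ge> 1)"

definition Sigma_fun :: "nat \<Rightarrow> nat \<Rightarrow> (real \<Rightarrow> nat list \<Rightarrow> nat list \<Rightarrow> real)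
    \<Rightarrow> (real \<Rightarrow> real) \<Rightarrow> real \<Rightarrow> real" where
  "Sigma_fun b q V \<omega> x = (MAX u \<in> words b q. \<omega> x / \<omega> (xw b x u) * (\<Sum>v\<in>words b q. V x u v))"

definition sigma :: "nat \<Rightarrow> real \<Rightarrow> (real \<Rightarrow> real) \<Rightarrow> nat \<Rightarrow> ereal" where
  "sigma b \<gamma> \<psi> q = (INF p \<in> {(V, \<omega>). weight_function \<omega> \<and> admissible b \<gamma> \<psi> q V}.
       Linf_norm (Sigma_fun b q (fst p) (snd p)))"

end

theory Submission
  imports Defs
begin

text \<open>The idea is Tsujii's: bound the energy \<open>\<integral>\<integral> m\<^sub>x(B(y,r))\<^sup>2 dy dx\<close> by \<open>O(r\<^sup>2)\<close> along a sequence
  \<open>r \<rightarrow> 0\<close>. By self-similarity \<open>m\<^sub>x\<close> is the average of \<open>b\<^sup>q\<close> affine images of the measures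
  \<open>m\<^sub>x\<^sub>(\<^sub>k\<^sub>)\<close>, so the energy at scale \<open>r\<close> is a double sum over pairs of words. For tangent pairs a
  product is estimated by the AM-GM inequality with weights \<open>V(k,l)\<close>, \<open>V(l,k)\<close>, which after weighting by
  \<open>\<omega>\<close> and integrating gives at most \<open>\<sigma>/(\<gamma>b)\<^sup>q < 1\<close> times the normalized energy at scale
  \<open>r/\<gamma>\<^sup>q\<close>. For the remaining pairs the two branches cross with slopes differing by more than
  \<open>\<delta>\<close>, and Fubini bounds their total contribution by \<open>O(r\<^sup>2)\<close>. Iteration yields the bound,
  and bounded energy gives a square integrable density by duality.\<close>

text \<open>The threshold \<open>(\<gamma> * real b) ^ q\<close> is a count of exponents. A branch
  over a word of length q contracts the fibre by \<gamma>^q, so the integral of its squared mass is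
  \<gamma>^q times the energy at radius r/\<gamma>^q, whereas normalizing both radii by their
  squares costs \<gamma>^(-2q). Averaging over pairs of words contributes b^(-2q), and integrating
  over all inverse branches gives back b^q. What remains of a bound \<Lambda> for \<Sigma> is
  \<Lambda>/(\<gamma>b)^q. The weight sits at x on one side of the recursion and at x(k) on the
  other; the quotient \<omega>(x)/\<omega>(x(k)) in \<Sigma> converts one into the other before the
  branches are integrated. The recursion needs 2r \<le> \<epsilon> and is iterated along a single
  geometric sequence of radii, so \<Theta> is never differentiated pointwise. The test inequality 2
  \<integral>f d\<Theta> \<le> \<integral>f^2 + D replaces this: it passes to the limit by Fatou,
  involves no roots of extended reals, and yields absolute continuity as well as the L^2
  bound.\<close>

section \<open>Periodic functions, weighted AM-GM and transversal sublevel sets\<close>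

lemma periodic_floor_shift:
  fixes f :: "real \<Rightarrow> real"
  assumes per: "\<And>x. f (x + 1) = f x"
  shows "f (x + of_int k) = f x"
proof (induction k rule: int_induct[where k = 0])
  case (step1 i)
  have "f (x + of_int (i + 1)) = f ((x + of_int i) + 1)" by (simp add: algebra_simps)
  then show ?case using step1 per by simp
next
  case (step2 i)
  have "f (x + of_int i) = f ((x + of_int (i - 1)) + 1)" by (simp add: algebra_simps)
  then show ?case using step2(2) by (simp only: per)
qed simp

lemma periodic_continuous_bounded:
  fixes f :: "real \<Rightarrow> real"
  assumes per: "\<And>x. f (x + 1) = f x" and cont: "continuous_on UNIV f"
  obtains M where "M > 0" "\<And>x. \<bar>f x\<bar> \<le> M"
proof -
  have "bounded (f ` {0..1})"
    by (intro compact_imp_bounded compact_continuous_image continuous_on_subset[OF cont]) auto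
  then obtain M where M: "M > 0" "\<And>x. x \<in> {0..1} \<Longrightarrow> \<bar>f x\<bar> \<le> M"
    unfolding bounded_pos by auto
  have "\<bar>f x\<bar> \<le> M" for x
  proof -
    have "f x = f (frac x)"
      using periodic_floor_shift[of f x "- \<lfloor>x\<rfloor>", OF per] by (simp add: frac_def)
    moreover have "frac x \<in> {0..1}" using frac_lt_1[of x] by simp
    ultimately show ?thesis using M(2) by simp
  qed
  with M(1) that show ?thesis by blast
qed

lemma periodic_continuous_uniform:
  fixes f :: "real \<Rightarrow> real"
  assumes per: "\<And>x. f (x + 1) = f x" and cont: "continuous_on UNIV f" and e: "e > 0"
  obtains d where "d > 0" "\<And>x y. \<bar>x - y\<bar> < d \<Longrightarrow> \<bar>f x - f y\<bar> < e"
proof -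
  \<comment> \<open>The interval leaves a margin of length 1 on either side of [0,1): once x is
    translated into [0,1), every y at distance less than 1 is translated into it as well.\<close>
  have "uniformly_continuous_on {-1..2} f"
    by (intro compact_uniformly_continuous continuous_on_subset[OF cont]) auto
  then obtain d where d: "d > 0"
    "\<And>x y. x \<in> {-1..2} \<Longrightarrow> y \<in> {-1..2} \<Longrightarrow> dist y x < d \<Longrightarrow> dist (f y) (f x) < e"
    unfolding uniformly_continuous_on_def using e by metis
  have "\<bar>f x - f y\<bar> < e" if "\<bar>x - y\<bar> < min d 1" for x y
  proof -
    obtain k :: int where x: "0 \<le> x + of_int k" "x + of_int k < 1"
    proof (rule that[of "- \<lfloor>x\<rfloor>"])
    qed (use floor_correct[of x] in \<open>simp_all, linarith\<close>)
    have "dist (f (x + of_int k)) (f (y + of_int k)) < e"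
      by (rule d(2)) (use x that in \<open>auto simp: dist_real_def\<close>)
    then show ?thesis
      by (simp only: periodic_floor_shift[where f=f, OF per] dist_real_def)
  qed
  with d(1) that[of "min d 1"] show ?thesis by auto
qed

text \<open>Expand the square of \<open>sqrt v * s - sqrt w * t\<close>. The condition
  \<open>v * w \<ge> 1\<close> is what admissibility provides for a tangent pair, with
  \<open>v\<close> and \<open>w\<close> the two values V(k,l) and V(l,k).\<close>

lemma weighted_AM_GM:
  fixes v w s t :: real
  assumes "v \<ge> 0" "w \<ge> 0" "v * w \<ge> 1" "s \<ge> 0" "t \<ge> 0"
  shows "s * t \<le> (v * s\<^sup>2 + w * t\<^sup>2) / 2"
proof -
  have "0 \<le> (sqrt v * s - sqrt w * t)\<^sup>2" by simp
  also have "\<dots> = v * s\<^sup>2 + w * t\<^sup>2 - 2 * sqrt (v * w) * (s * t)"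
    using assms by (simp add: power2_diff power_mult_distrib real_sqrt_mult)
  finally have "2 * sqrt (v * w) * (s * t) \<le> v * s\<^sup>2 + w * t\<^sup>2" by simp
  moreover have "1 * (s * t) \<le> sqrt (v * w) * (s * t)"
    using assms by (intro mult_right_mono) auto
  ultimately show ?thesis by simp
qed

text \<open>On a cell of length 1/N that meets the set, the derivative is at least \<open>\<delta>/2\<close> throughout,
  so by the mean value theorem the part of the set in that cell has diameter at most \<open>4\<rho>/\<delta>\<close>.\<close>

lemma emeasure_transversal_sublevel:
  fixes h h' :: "real \<Rightarrow> real"
  assumes deriv: "\<And>x. (h has_real_derivative h' x) (at x)"
    and uc: "\<And>x y. \<bar>x - y\<bar> < 1 / real N \<Longrightarrow> \<bar>h' x - h' y\<bar> < \<delta> / 2"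
    and N: "N > 0" and \<delta>: "\<delta> > 0" and \<rho>: "\<rho> \<ge> 0"
  shows "emeasure lborel {x \<in> {0..<1}. \<bar>h x\<bar> \<le> \<rho> \<and> \<bar>h' x\<bar> > \<delta>} \<le> ennreal (8 * real N * \<rho> / \<delta>)"
proof -
  define A where "A j = {x. real j / N \<le> x \<and> x < real (Suc j) / N \<and> \<bar>h x\<bar> \<le> \<rho> \<and> \<bar>h' x\<bar> > \<delta>}" for j
  have diam: "y - x \<le> 4 * \<rho> / \<delta>" if x: "x \<in> A j" and y: "y \<in> A j" and "x < y" for x y j
  proof -
    obtain z where z: "z > x" "z < y" "h y - h x = (y - x) * h' z"
      using MVT2[OF \<open>x < y\<close>, of h h'] deriv by blast
    have "real (Suc j) / N = real j / N + 1 / N" by (simp add: add_divide_distrib)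
    moreover have "real j / N \<le> x" "y < real (Suc j) / N" using x y by (auto simp: A_def)
    ultimately have "y - x < 1 / N" by linarith
    then have "\<bar>x - z\<bar> < 1 / N" using z(1,2) by linarith
    then have "\<bar>h' x - h' z\<bar> < \<delta> / 2" by (rule uc)
    moreover have "\<bar>h' x\<bar> > \<delta>" using x by (simp add: A_def)
    ultimately have "\<bar>h' z\<bar> > \<delta> / 2" by linarith
    then have "(y - x) * (\<delta> / 2) \<le> (y - x) * \<bar>h' z\<bar>"
      using \<open>x < y\<close> by (intro mult_left_mono) auto
    also have "\<dots> = \<bar>h y - h x\<bar>"
      using z \<open>x < y\<close> by (simp add: abs_mult)
    also have "\<dots> \<le> 2 * \<rho>"
      using x y by (auto simp: A_def)
    finally show ?thesis using \<delta> by (simp add: field_simps)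
  qed
  \<comment> \<open>Centring at an arbitrary point of \<open>A j\<close> doubles the diameter bound,
    so the N cells contribute \<open>8 * \<rho> / \<delta>\<close> each.\<close>
  have "\<exists>z. A j \<subseteq> {z - 4 * \<rho> / \<delta>..z + 4 * \<rho> / \<delta>}" for j
  proof (cases "A j = {}")
    case False
    then obtain z where z: "z \<in> A j" by auto
    have "x \<in> {z - 4 * \<rho> / \<delta>..z + 4 * \<rho> / \<delta>}" if x: "x \<in> A j" for x
    proof -
      have "4 * \<rho> / \<delta> \<ge> 0" using \<rho> \<delta> by simp
      then show ?thesis
        using diam[OF x z] diam[OF z x] by (cases x z rule: linorder_cases) auto
    qed
    then show ?thesis by blast
  qed auto
  then obtain z where z: "\<And>j. A j \<subseteq> {z j - 4 * \<rho> / \<delta>..z j + 4 * \<rho> / \<delta>}" by metis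
  have "{x \<in> {0..<1}. \<bar>h x\<bar> \<le> \<rho> \<and> \<bar>h' x\<bar> > \<delta>} \<subseteq> (\<Union>j<N. {z j - 4 * \<rho> / \<delta>..z j + 4 * \<rho> / \<delta>})"
  proof
    fix x assume x: "x \<in> {x \<in> {0..<1}. \<bar>h x\<bar> \<le> \<rho> \<and> \<bar>h' x\<bar> > \<delta>}"
    define j where "j = nat \<lfloor>x * N\<rfloor>"
    have j: "real j \<le> x * N" "x * N < real j + 1"
      using x by (auto simp: j_def)
    have jN: "real j < N"
    proof -
      have "x * N < N" using x N by simp
      with j(1) show ?thesis by linarith
    qed
    have "real j / N \<le> x" "x < real (Suc j) / N"
      using j N by (simp_all add: pos_divide_le_eq pos_less_divide_eq add.commute)
    then have "x \<in> A j" using x by (simp add: A_def)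
    then show "x \<in> (\<Union>j<N. {z j - 4 * \<rho> / \<delta>..z j + 4 * \<rho> / \<delta>})"
      using jN by (intro UN_I[of j] subsetD[OF z]) auto
  qed
  then have "emeasure lborel {x \<in> {0..<1}. \<bar>h x\<bar> \<le> \<rho> \<and> \<bar>h' x\<bar> > \<delta>}
      \<le> emeasure lborel (\<Union>j<N. {z j - 4 * \<rho> / \<delta>..z j + 4 * \<rho> / \<delta>})"
    by (intro emeasure_mono) auto
  also have "\<dots> \<le> (\<Sum>j<N. emeasure lborel {z j - 4 * \<rho> / \<delta>..z j + 4 * \<rho> / \<delta>})"
    by (intro emeasure_subadditive_finite) auto
  also have "\<dots> = (\<Sum>j<N. ennreal (8 * \<rho> / \<delta>))"
  proof (intro sum.cong refl)
    fix j
    have "4 * \<rho> / \<delta> \<ge> 0" using \<rho> \<delta> by simp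
    then have "z j - 4 * \<rho> / \<delta> \<le> z j + 4 * \<rho> / \<delta>" by linarith
    then show "emeasure lborel {z j - 4 * \<rho> / \<delta>..z j + 4 * \<rho> / \<delta>} = ennreal (8 * \<rho> / \<delta>)"
      by simp
  qed
  also have "\<dots> = ennreal (8 * real N * \<rho> / \<delta>)"
    using \<rho> \<delta> by (simp add: ennreal_of_nat_eq_real_of_nat ennreal_mult[symmetric] algebra_simps)
  finally show ?thesis .
qed

section \<open>Square integrable densities by duality\<close>

text \<open>Outer regularity upgrades the inequality from open sets to Borel sets, i.e. to all simple
  functions; a simple function below the density then absorbs half of the right-hand side.\<close>

context
  fixes \<Theta> :: "'a::euclidean_space measure" and D :: ennreal
  assumes fin: "finite_measure \<Theta>" and sets: "sets \<Theta> = sets borel" and D: "D < top"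
    and open_ineq: "\<And>(I :: ennreal set) U. finite I \<Longrightarrow> (\<And>c. c \<in> I \<Longrightarrow> c < top) \<Longrightarrow> (\<And>c. c \<in> I \<Longrightarrow> open (U c)) \<Longrightarrow>
        2 * (\<integral>\<^sup>+z. (\<Sum>c\<in>I. c * indicator (U c) z) \<partial>\<Theta>)
          \<le> (\<integral>\<^sup>+z. (\<Sum>c\<in>I. c * indicator (U c) z)\<^sup>2 \<partial>lborel) + D"
begin

lemma simple_ineq:
  assumes s: "simple_function lborel s" and s_fin: "\<And>z. s z < top"
  shows "2 * (\<integral>\<^sup>+z. s z \<partial>\<Theta>) \<le> (\<integral>\<^sup>+z. (s z)\<^sup>2 \<partial>lborel) + D"
proof -
  define I where "I = range s"
  have I: "finite I" "\<And>c. c \<in> I \<Longrightarrow> c < top"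
    using s s_fin by (auto simp: I_def simple_function_def)
  have [measurable]: "s \<in> borel_measurable borel"
    using borel_measurable_simple_function[OF s] by simp
  define A where "A c = s -` {c}" for c
  have A[measurable]: "A c \<in> sets borel" for c
    unfolding A_def using measurable_sets_borel[of s borel "{c}"] by simp
  have s_eq: "s z = (\<Sum>c\<in>I. c * indicator (A c) z)" for z
  proof -
    have "(\<Sum>c\<in>I. c * indicator (A c) z) = (\<Sum>c\<in>I. if c = s z then c else 0)"
      by (intro sum.cong) (auto simp: A_def indicator_def)
    then show ?thesis using I by (simp add: I_def)
  qed
  define M where "M = (\<Sum>c\<in>I. c)"
  have M: "M < top" unfolding M_def using I by (simp add: less_top)
  have sum_le_M: "(\<Sum>c\<in>I. c * indicator (B c) z) \<le> M" for B :: "ennreal \<Rightarrow> 'a set" and z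
    unfolding M_def by (intro sum_mono) (auto simp: indicator_def)
  have approx: "2 * (\<integral>\<^sup>+z. s z \<partial>\<Theta>) \<le> (\<integral>\<^sup>+z. (s z)\<^sup>2 \<partial>lborel) + 3 * M * M * ennreal e + D"
    if "e > 0" for e :: real
  proof -
    \<comment> \<open>The excess \<open>U c - A c\<close> is controlled instead of the measure of
      \<open>U c\<close>, because a level set such as that of 0 may have infinite measure.\<close>
    have "\<exists>U. open U \<and> A c \<subseteq> U \<and> emeasure lborel (U - A c) \<le> ennreal e" for c
      using outer_regular_lborel_le[OF A \<open>e > 0\<close>] by metis
    then obtain U where U: "\<And>c. open (U c)" "\<And>c. A c \<subseteq> U c"
        "\<And>c. emeasure lborel (U c - A c) \<le> ennreal e"
      by metis
    have [measurable]: "U c \<in> sets borel" for c using U(1) by auto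
    define p where "p z = (\<Sum>c\<in>I. c * indicator (U c - A c) z)" for z
    have [measurable]: "p \<in> borel_measurable borel" unfolding p_def by measurable
    have split: "(\<Sum>c\<in>I. c * indicator (U c) z) = s z + p z" for z
      unfolding s_eq p_def sum.distrib[symmetric]
      by (intro sum.cong refl) (use U(2) in \<open>auto simp: indicator_def\<close>)
    \<comment> \<open>Since \<open>s\<close> and \<open>p\<close> are both bounded by
      \<open>M\<close>, the excess enters the square only linearly, and its contribution vanishes
      with \<open>e\<close>.\<close>
    have sq: "(s z + p z)\<^sup>2 \<le> (s z)\<^sup>2 + 3 * M * p z" for z
    proof -
      have "s z \<le> M" "p z \<le> M" using sum_le_M s_eq p_def by auto
      then have "2 * s z * p z + p z * p z \<le> 2 * M * p z + M * p z"
        by (intro add_mono mult_mono) auto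
      also have "\<dots> = 3 * M * p z"
      proof -
        have "(3 :: ennreal) = 2 + 1" by simp
        then show ?thesis by (simp only: distrib_right mult_1)
      qed
      finally have "(s z)\<^sup>2 + (2 * s z * p z + p z * p z) \<le> (s z)\<^sup>2 + 3 * M * p z"
        by (rule add_left_mono)
      moreover have "(s z + p z)\<^sup>2 = (s z)\<^sup>2 + (2 * s z * p z + p z * p z)"
        by (simp add: power2_sum) (simp add: power2_eq_square algebra_simps)
      ultimately show ?thesis by simp
    qed
    have "(\<integral>\<^sup>+z. p z \<partial>lborel) = (\<Sum>c\<in>I. c * emeasure lborel (U c - A c))"
      unfolding p_def by (subst nn_integral_sum) (auto simp: nn_integral_cmult)
    also have "\<dots> \<le> (\<Sum>c\<in>I. c * ennreal e)"
      by (intro sum_mono mult_left_mono U(3)) auto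
    also have "\<dots> = M * ennreal e" by (simp add: M_def sum_distrib_right)
    finally have p_int: "(\<integral>\<^sup>+z. p z \<partial>lborel) \<le> M * ennreal e" .
    have "2 * (\<integral>\<^sup>+z. s z \<partial>\<Theta>) \<le> 2 * (\<integral>\<^sup>+z. (\<Sum>c\<in>I. c * indicator (U c) z) \<partial>\<Theta>)"
      by (intro mult_left_mono nn_integral_mono) (auto simp: split)
    also have "\<dots> \<le> (\<integral>\<^sup>+z. (\<Sum>c\<in>I. c * indicator (U c) z)\<^sup>2 \<partial>lborel) + D"
      by (intro open_ineq I U(1))
    also have "\<dots> \<le> (\<integral>\<^sup>+z. (s z)\<^sup>2 + 3 * M * p z \<partial>lborel) + D"
      by (intro add_mono nn_integral_mono) (auto simp: split sq)
    also have "(\<integral>\<^sup>+z. (s z)\<^sup>2 + 3 * M * p z \<partial>lborel) = (\<integral>\<^sup>+z. (s z)\<^sup>2 \<partial>lborel) + 3 * M * (\<integral>\<^sup>+z. p z \<partial>lborel)"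
      by (subst nn_integral_add) (auto simp: nn_integral_cmult)
    also have "\<dots> \<le> (\<integral>\<^sup>+z. (s z)\<^sup>2 \<partial>lborel) + 3 * M * (M * ennreal e)"
      by (intro add_mono mult_left_mono p_int) auto
    finally show ?thesis by (simp add: mult.assoc)
  qed
  define K where "K = 3 * M * M"
  have K: "K < top" using M by (simp add: K_def ennreal_mult_less_top)
  show ?thesis
  proof (rule ennreal_le_epsilon)
    fix e :: real assume e: "e > 0"
    define d where "d = e / (enn2real K + 1)"
    have d: "d > 0" using e by (simp add: d_def add_nonneg_pos)
    have "K * ennreal d = ennreal (enn2real K * d)"
      using K d by (simp add: ennreal_mult less_top)
    also have "\<dots> \<le> ennreal e"
    proof (intro ennreal_leI)
      have "k * (e / (k + 1)) \<le> e" if "k \<ge> 0" for k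
        using e that by (simp add: field_simps)
      then show "enn2real K * d \<le> e" by (simp add: d_def)
    qed
    finally have Kd: "K * ennreal d \<le> ennreal e" .
    have "2 * (\<integral>\<^sup>+z. s z \<partial>\<Theta>) \<le> (\<integral>\<^sup>+z. (s z)\<^sup>2 \<partial>lborel) + K * ennreal d + D"
      using approx[OF d] by (simp only: K_def)
    also have "\<dots> \<le> (\<integral>\<^sup>+z. (s z)\<^sup>2 \<partial>lborel) + ennreal e + D"
      by (intro add_mono order_refl Kd)
    finally show "2 * (\<integral>\<^sup>+z. s z \<partial>\<Theta>) \<le> (\<integral>\<^sup>+z. (s z)\<^sup>2 \<partial>lborel) + D + ennreal e"
      by (simp only: ac_simps)
  qed
qed

lemma absolutely_continuous_lborel: "absolutely_continuous lborel \<Theta>"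
  unfolding absolutely_continuous_def
proof
  fix A assume A: "A \<in> null_sets (lborel :: 'a measure)"
  then have [measurable]: "A \<in> sets borel" and A0: "emeasure lborel A = 0" by auto
  have "emeasure \<Theta> A = 0"
  proof (rule ccontr)
    assume "emeasure \<Theta> A \<noteq> 0"
    interpret finite_measure \<Theta> by (rule fin)
    define m where "m = measure \<Theta> A"
    have m: "emeasure \<Theta> A = ennreal m" "m > 0"
      using \<open>emeasure \<Theta> A \<noteq> 0\<close> by (auto simp: m_def emeasure_eq_measure zero_less_measure_iff)
    \<comment> \<open>On a Lebesgue null set the quadratic term vanishes, so the test function
      \<open>c * indicator A\<close> would give \<open>2 * c * m \<le> D\<close> for every
      \<open>c\<close>. This choice turns that into \<open>2 * (D + 1) \<le> D\<close>.\<close>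
    define c where "c = (enn2real D + 1) / m"
    have c: "c > 0" using m by (simp add: c_def add_nonneg_pos)
    have "2 * (\<integral>\<^sup>+z. ennreal c * indicator A z \<partial>\<Theta>)
        \<le> (\<integral>\<^sup>+z. (ennreal c * indicator A z)\<^sup>2 \<partial>lborel) + D"
    proof (rule simple_ineq)
      show "simple_function lborel (\<lambda>z. ennreal c * indicator A z)"
        by (rule simple_function_mult[OF simple_function_const simple_function_indicator]) simp
    qed (simp add: ennreal_mult_less_top less_top indicator_def)
    moreover have "(\<integral>\<^sup>+z. (ennreal c * indicator A z)\<^sup>2 \<partial>lborel) = (\<integral>\<^sup>+z. (ennreal c)\<^sup>2 * indicator A z \<partial>lborel)"
      by (intro nn_integral_cong) (auto simp: indicator_def)
    moreover have "\<dots> = 0" using A0 by (subst nn_integral_cmult_indicator) auto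
    moreover have "(\<integral>\<^sup>+z. ennreal c * indicator A z \<partial>\<Theta>) = ennreal c * ennreal m"
      using sets m by (subst nn_integral_cmult_indicator) auto
    moreover have "ennreal c * ennreal m = ennreal (enn2real D + 1)"
      using m c by (subst ennreal_mult[symmetric]) (auto simp: c_def)
    moreover have "2 * ennreal (enn2real D + 1) = ennreal (2 * (enn2real D + 1))"
      by (subst ennreal_mult) auto
    ultimately have "ennreal (2 * (enn2real D + 1)) \<le> D" by (simp only: add_0_left)
    also have "D = ennreal (enn2real D)" using D by simp
    finally have "2 * (enn2real D + 1) \<le> enn2real D" by (subst (asm) ennreal_le_iff) auto
    then have "enn2real D + 2 \<le> 0" by (simp add: distrib_left)
    moreover have "enn2real D \<ge> 0" by simp
    ultimately show False by (meson add_nonneg_pos not_le zero_less_numeral)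
  qed
  then show "A \<in> null_sets \<Theta>" using sets by (auto simp: null_sets_def)
qed

lemma square_integrable_density:
  obtains f :: "'a \<Rightarrow> real" where "f \<in> borel_measurable borel" "\<And>z. f z \<ge> 0"
    "\<Theta> = density lborel (\<lambda>z. ennreal (f z))" "(\<integral>\<^sup>+z. ennreal ((f z)\<^sup>2) \<partial>lborel) \<le> D"
proof -
  interpret finite_measure \<Theta> by (rule fin)
  obtain g where g[measurable]: "g \<in> borel_measurable lborel" and \<Theta>: "density lborel g = \<Theta>"
    using sigma_finite_measure.Radon_Nikodym[OF sigma_finite_lborel absolutely_continuous_lborel] sets by auto
  have "(\<integral>\<^sup>+z. g z \<partial>lborel) = emeasure \<Theta> UNIV"
    unfolding \<Theta>[symmetric] by (subst emeasure_density) auto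
  then have g_int: "(\<integral>\<^sup>+z. g z \<partial>lborel) < top"
    by (simp add: emeasure_eq_measure)
  obtain s where s: "\<And>i. simple_function lborel (s i)" "incseq s" "\<And>i z. s i z < top"
      "\<And>z. (SUP i. s i z) = g z"
    using borel_measurable_implies_simple_function_sequence'[OF g] by blast
  have [measurable]: "s i \<in> borel_measurable borel" for i
    using borel_measurable_simple_function[OF s(1)[of i]] by simp
  have s_le: "s i z \<le> g z" for i z
    unfolding s(4)[symmetric] by (rule SUP_upper) auto
  have s_sq: "(\<integral>\<^sup>+z. (s i z)\<^sup>2 \<partial>lborel) \<le> D" for i
  proof -
    \<comment> \<open>Cancelling the integral of the square of \<open>s i\<close> on both sides
      requires it to be finite. It is, because \<open>s i\<close> is bounded and lies below the
      integrable density \<open>g\<close>.\<close>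
    define M where "M = Max (range (s i))"
    have "finite (range (s i))" using s(1)[of i] by (simp add: simple_function_def)
    then have M: "M < top" "\<And>z. s i z \<le> M"
      unfolding M_def using s(3) by (auto simp: Max_ge)
    have "(\<integral>\<^sup>+z. (s i z)\<^sup>2 \<partial>lborel) \<le> (\<integral>\<^sup>+z. M * g z \<partial>lborel)"
      unfolding power2_eq_square by (intro nn_integral_mono mult_mono M s_le) auto
    also have "\<dots> < top" using g_int M by (simp add: nn_integral_cmult ennreal_mult_less_top)
    finally have fin': "(\<integral>\<^sup>+z. (s i z)\<^sup>2 \<partial>lborel) < top" .
    have "2 * (\<integral>\<^sup>+z. (s i z)\<^sup>2 \<partial>lborel) \<le> 2 * (\<integral>\<^sup>+z. g z * s i z \<partial>lborel)"
      unfolding power2_eq_square by (intro mult_left_mono nn_integral_mono mult_right_mono s_le) auto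
    also have "\<dots> = 2 * (\<integral>\<^sup>+z. s i z \<partial>\<Theta>)"
      unfolding \<Theta>[symmetric] by (subst nn_integral_density) auto
    also have "\<dots> \<le> (\<integral>\<^sup>+z. (s i z)\<^sup>2 \<partial>lborel) + D"
      by (rule simple_ineq[OF s(1,3)])
    finally have "(\<integral>\<^sup>+z. (s i z)\<^sup>2 \<partial>lborel) + (\<integral>\<^sup>+z. (s i z)\<^sup>2 \<partial>lborel)
        \<le> (\<integral>\<^sup>+z. (s i z)\<^sup>2 \<partial>lborel) + D"
      by (simp only: mult_2)
    with fin' show ?thesis by (auto simp: ennreal_add_left_cancel_le)
  qed
  have sq_sup: "(g z)\<^sup>2 = (SUP i. (s i z)\<^sup>2)" for z
  proof -
    have "(\<lambda>i. s i z) \<longlonglongrightarrow> g z"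
      unfolding s(4)[symmetric] using s(2) by (intro LIMSEQ_SUP) (auto simp: incseq_def le_fun_def)
    then have "(\<lambda>i. (s i z)\<^sup>2) \<longlonglongrightarrow> (g z)\<^sup>2"
      unfolding power2_eq_square by (intro tendsto_mult_ennreal) auto
    moreover have "incseq (\<lambda>i. (s i z)\<^sup>2)"
      using s(2) by (auto simp: incseq_def le_fun_def intro!: power_mono)
    ultimately show ?thesis using LIMSEQ_SUP LIMSEQ_unique by blast
  qed
  have "(\<integral>\<^sup>+z. (g z)\<^sup>2 \<partial>lborel) = (SUP i. \<integral>\<^sup>+z. (s i z)\<^sup>2 \<partial>lborel)"
    unfolding sq_sup
    by (intro nn_integral_monotone_convergence_SUP)
       (use s(2) in \<open>auto simp: incseq_def le_fun_def intro!: power_mono\<close>)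
  also have "\<dots> \<le> D" by (intro SUP_least s_sq)
  finally have g_sq: "(\<integral>\<^sup>+z. (g z)\<^sup>2 \<partial>lborel) \<le> D" .
  \<comment> \<open>\<open>enn2real\<close> sends \<infinity> to 0, so the real-valued density
    differs from \<open>g\<close> only where \<open>g\<close> is infinite, a null set.\<close>
  have "AE z in lborel. g z \<noteq> \<infinity>"
    using g_int by (intro nn_integral_PInf_AE) auto
  then have ae: "AE z in lborel. ennreal (enn2real (g z)) = g z"
    by eventually_elim (simp add: less_top)
  show ?thesis
  proof (rule that[of "\<lambda>z. enn2real (g z)"])
    show "\<Theta> = density lborel (\<lambda>z. ennreal (enn2real (g z)))"
      unfolding \<Theta>[symmetric] using ae by (intro density_cong) auto
    have "(\<integral>\<^sup>+z. ennreal ((enn2real (g z))\<^sup>2) \<partial>lborel) = (\<integral>\<^sup>+z. (g z)\<^sup>2 \<partial>lborel)"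
      using ae by (intro nn_integral_cong_AE) (auto simp: ennreal_power[symmetric])
    then show "(\<integral>\<^sup>+z. ennreal ((enn2real (g z))\<^sup>2) \<partial>lborel) \<le> D" using g_sq by simp
  qed (use g in auto)
qed

end

section \<open>Words, Bernoulli measure and inverse branches\<close>

lemma sum_lessThan_add:
  fixes f :: "nat \<Rightarrow> 'a::comm_monoid_add"
  shows "(\<Sum>j<q + m. f j) = (\<Sum>j<q. f j) + (\<Sum>j<m. f (q + j))"
  by (induction m) (simp_all add: add.assoc)

lemma sets_bernoulli[measurable_cong]: "sets (bernoulli b) = sets (PiM UNIV (\<lambda>_. count_space UNIV))"
  unfolding bernoulli_def by (intro sets_PiM_cong) auto

lemma space_bernoulli[simp]: "space (bernoulli b) = UNIV"
  by (simp add: bernoulli_def space_PiM)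

lemma measurable_coord: "(\<lambda>i. i k) \<in> measurable (bernoulli b) (count_space UNIV)"
  by measurable

lemma prob_space_bernoulli: "prob_space (bernoulli b)"
  unfolding bernoulli_def by (intro prob_space_PiM prob_space_measure_pmf)

lemma words_0[simp]: "words b 0 = {[]}"
  by (auto simp: words_def)

lemma words_Suc: "words b (Suc q) = (\<lambda>(a, w). a # w) ` ({0..<b} \<times> words b q)"
  by (auto simp: words_def image_iff length_Suc_conv)

lemma finite_words[simp]: "finite (words b q)"
  by (induction q) (auto simp: words_Suc)

lemma sum_words_Suc:
  fixes f :: "nat list \<Rightarrow> 'a::comm_monoid_add"
  shows "(\<Sum>k\<in>words b (Suc q). f k) = (\<Sum>a\<in>{0..<b}. \<Sum>w\<in>words b q. f (a # w))"
  unfolding words_Suc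
  by (subst sum.reindex) (auto simp: inj_on_def sum.cartesian_product case_prod_unfold)

lemma concat_seq_Nil[simp]: "concat_seq [] u = u"
  by (simp add: concat_seq_def)

lemma concat_seq_Cons: "concat_seq (a # w) u = case_nat a (concat_seq w u)"
  by (auto simp: concat_seq_def split: nat.split)

lemma measurable_concat_seq[measurable]: "concat_seq k \<in> measurable (bernoulli b) (bernoulli b')"
proof -
  have "concat_seq k \<in> measurable (bernoulli b) (PiM UNIV (\<lambda>_. count_space UNIV))"
    by (rule measurable_PiM_single') (auto simp: concat_seq_def intro: measurable_coord)
  then show ?thesis by (simp cong: measurable_cong_sets add: sets_bernoulli)
qed

text \<open>Prepending an independent uniform letter preserves the Bernoulli measure. The factor
  \<open>of_nat b\<close> stands on the left so that iteration involves no division of extended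
  reals.\<close>

lemma nn_integral_bernoulli_Suc:
  assumes b: "b > 0" and f: "f \<in> borel_measurable (bernoulli b)"
  shows "of_nat b * (\<integral>\<^sup>+u. f u \<partial>bernoulli b) = (\<Sum>a\<in>{0..<b}. \<integral>\<^sup>+u. f (case_nat a u) \<partial>bernoulli b)"
proof -
  let ?M = "measure_pmf (pmf_of_set {0..<b})"
  interpret B: sequence_space ?M by unfold_locales
  interpret P: prob_space "bernoulli b" by (rule prob_space_bernoulli)
  have iter: "distr (?M \<Otimes>\<^sub>M bernoulli b) (bernoulli b) (\<lambda>(s, \<omega>). case_nat s \<omega>) = bernoulli b"
    using B.PiM_iter unfolding bernoulli_def .
  have [measurable]: "(\<lambda>(s, \<omega>). case_nat s \<omega>) \<in> measurable (?M \<Otimes>\<^sub>M bernoulli b) (bernoulli b)"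
    unfolding bernoulli_def by measurable
  note f[measurable]
  have "(\<integral>\<^sup>+u. f u \<partial>bernoulli b) = (\<integral>\<^sup>+z. f (case z of (s, \<omega>) \<Rightarrow> case_nat s \<omega>) \<partial>(?M \<Otimes>\<^sub>M bernoulli b))"
    by (subst (1) iter[symmetric], subst nn_integral_distr) auto
  also have "\<dots> = (\<integral>\<^sup>+a. \<integral>\<^sup>+u. f (case_nat a u) \<partial>bernoulli b \<partial>?M)"
    by (subst P.nn_integral_fst[symmetric]) auto
  also have "\<dots> = (\<Sum>a\<in>{0..<b}. \<integral>\<^sup>+u. f (case_nat a u) \<partial>bernoulli b) / of_nat b"
    using b by (subst nn_integral_pmf_of_set) auto
  finally show ?thesis
    using b by (simp add: ennreal_times_divide mult.commute[of "of_nat b"] mult_divide_eq_ennreal)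
qed

lemma nn_integral_bernoulli_words:
  assumes b: "b > 0" and f: "f \<in> borel_measurable (bernoulli b)"
  shows "of_nat (b ^ q) * (\<integral>\<^sup>+u. f u \<partial>bernoulli b)
    = (\<Sum>k\<in>words b q. \<integral>\<^sup>+u. f (concat_seq k u) \<partial>bernoulli b)"
  using f
proof (induction q arbitrary: f)
  case (Suc q)
  note Suc.prems[measurable]
  have [measurable]: "(\<lambda>u. case_nat a u) \<in> measurable (bernoulli b) (bernoulli b)" for a
    using measurable_concat_seq[of "[a]" b b] by (simp add: concat_seq_Cons[abs_def])
  have "of_nat (b ^ Suc q) * (\<integral>\<^sup>+u. f u \<partial>bernoulli b)
      = of_nat (b ^ q) * (of_nat b * (\<integral>\<^sup>+u. f u \<partial>bernoulli b))"
    by (simp add: ac_simps)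
  also have "\<dots> = (\<Sum>a\<in>{0..<b}. of_nat (b ^ q) * (\<integral>\<^sup>+u. f (case_nat a u) \<partial>bernoulli b))"
    by (simp only: nn_integral_bernoulli_Suc[OF b Suc.prems] sum_distrib_left)
  also have "\<dots> = (\<Sum>a\<in>{0..<b}. \<Sum>k\<in>words b q. \<integral>\<^sup>+u. f (case_nat a (concat_seq k u)) \<partial>bernoulli b)"
    by (intro sum.cong refl Suc.IH) measurable
  finally show ?case by (simp only: sum_words_Suc concat_seq_Cons)
qed simp

text \<open>The measure is carried by all functions from \<open>nat\<close> to \<open>nat\<close>,
  while tangency in \<open>Eset\<close> quantifies over \<open>seqs b\<close> only; this bridges the
  two.\<close>

lemma AE_bernoulli_seqs:
  assumes b: "b > 0"
  shows "AE u in bernoulli b. u \<in> seqs b"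
proof -
  interpret B: product_prob_space "\<lambda>_. measure_pmf (pmf_of_set {0..<b})" "UNIV :: nat set"
    by unfold_locales
  have "AE u in bernoulli b. u n < b" for n
  proof -
    have "AE a in distr (bernoulli b) (measure_pmf (pmf_of_set {0..<b})) (\<lambda>u. u n). a < b"
      unfolding bernoulli_def B.PiM_component[OF UNIV_I]
      using b by (auto simp: AE_measure_pmf_iff)
    then show ?thesis
      by (subst (asm) AE_distr_iff) (auto simp: bernoulli_def)
  qed
  then show ?thesis unfolding seqs_def by (simp add: AE_all_countable)
qed

lemma xw_Nil[simp]: "xw b x [] = x"
  by (simp add: xw_def)

text \<open>The first letter is the inverse branch applied first, so inductions on words peel
  letters off the head.\<close>

lemma xw_Cons:
  assumes "b > 0"
  shows "xw b x (a # w) = xw b ((x + real a) / real b) w"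
proof -
  have "(\<Sum>k<length (a # w). real ((a # w) ! k) * real b ^ k)
      = real a + real b * (\<Sum>k<length w. real (w ! k) * real b ^ k)"
    by (simp only: length_Cons sum.lessThan_Suc_shift) (simp add: sum_distrib_left ac_simps)
  then show ?thesis using assms by (simp add: xw_def field_simps)
qed

lemma measurable_xw[measurable]: "(\<lambda>x. xw b x k) \<in> borel_measurable borel"
  unfolding xw_def by measurable

lemma xw_in_unit:
  assumes b: "b > 0" and x: "x \<in> {0..<1}" and k: "k \<in> words b q"
  shows "xw b x k \<in> {0..<1}"
  using x k
proof (induction k arbitrary: x q)
  case (Cons a k)
  have a: "a < b" "k \<in> words b (length k)" using Cons.prems by (auto simp: words_def)
  then have "real a + 1 \<le> real b" by linarith
  then have "(x + real a) / real b \<in> {0..<1}"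
    using Cons.prems(1) b by (auto simp: field_simps)
  then show ?case using Cons.IH a(2) xw_Cons[OF b] by simp
qed simp

text \<open>Invariance of Lebesgue measure under x \<mapsto> bx mod 1, seen from the transfer
  operator: the branch with letter a maps [0,1) onto [a/b, (a+1)/b) with Jacobian 1/b, and these
  images partition [0,1).\<close>

lemma nn_integral_inverse_branches_1:
  fixes G :: "real \<Rightarrow> ennreal"
  assumes b: "b > 0" and G[measurable]: "G \<in> borel_measurable borel"
  shows "(\<Sum>a\<in>{0..<b}. \<integral>\<^sup>+x. G ((x + real a) / real b) * indicator {0..<1} x \<partial>lborel)
    = of_nat b * (\<integral>\<^sup>+x. G x * indicator {0..<1} x \<partial>lborel)"
proof -
  have 1: "(\<integral>\<^sup>+x. G ((x + real a) / real b) * indicator {0..<1} x \<partial>lborel)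
      = of_nat b * (\<integral>\<^sup>+x. G x * indicator {real a / real b..<real (Suc a) / real b} x \<partial>lborel)" for a
  proof -
    have "(\<integral>\<^sup>+x. G ((x + real a) / real b) * indicator {0..<1} x \<partial>lborel)
      = ennreal \<bar>real b\<bar> * (\<integral>\<^sup>+x. G ((- real a + real b * x + real a) / real b) * indicator {0..<1} (- real a + real b * x) \<partial>lborel)"
      using b by (intro nn_integral_real_affine) auto
    also have "\<dots> = of_nat b * (\<integral>\<^sup>+x. G x * indicator {real a / real b..<real (Suc a) / real b} x \<partial>lborel)"
    proof -
      have "- real a + real b * x \<in> {0..<1} \<longleftrightarrow> x \<in> {real a / real b..<real (Suc a) / real b}" for x
        using b by (auto simp: pos_divide_le_eq pos_less_divide_eq algebra_simps)
      then show ?thesis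
        using b by (simp add: indicator_def ennreal_of_nat_eq_real_of_nat)
    qed
    finally show ?thesis .
  qed
  have ind: "(\<Sum>a\<in>{0..<b}. indicator {real a / real b..<real (Suc a) / real b} x) = (indicator {0..<1} x :: ennreal)" for x
  proof -
    have disj: "disjoint_family_on (\<lambda>a. {real a / real b..<real (Suc a) / real b}) {0..<b}"
      unfolding disjoint_family_on_def
    proof (intro ballI impI)
      fix m n :: nat assume "m \<noteq> n"
      then consider "Suc m \<le> n" | "Suc n \<le> m" by linarith
      then show "{real m / real b..<real (Suc m) / real b} \<inter> {real n / real b..<real (Suc n) / real b} = {}"
      proof cases
        case 1
        then have "real (Suc m) / real b \<le> real n / real b" by (intro divide_right_mono) linarith+
        then show ?thesis by auto
      next
        case 2
        then have "real (Suc n) / real b \<le> real m / real b" by (intro divide_right_mono) linarith+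
        then show ?thesis by auto
      qed
    qed
    have "(\<Union>a\<in>{0..<b}. {real a / real b..<real (Suc a) / real b}) = {0..<1}"
    proof (intro set_eqI iffI)
      fix x assume "x \<in> (\<Union>a\<in>{0..<b}. {real a / real b..<real (Suc a) / real b})"
      then obtain a where a: "a < b" "real a / real b \<le> x" "x < real (Suc a) / real b" by auto
      have "real (Suc a) / real b \<le> 1" using a(1) by (simp del: of_nat_Suc)
      moreover have "0 \<le> real a / real b" by simp
      ultimately have "0 \<le> x" "x < 1" using a(2,3) by linarith+
      then show "x \<in> {0..<1}" by simp
    next
      fix x :: real assume x: "x \<in> {0..<1}"
      define a where "a = nat \<lfloor>x * real b\<rfloor>"
      have a: "real a \<le> x * real b" "x * real b < real (Suc a)"
      proof -
        have "real a = of_int \<lfloor>x * real b\<rfloor>" using x by (simp add: a_def)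
        then show "real a \<le> x * real b" "x * real b < real (Suc a)"
          using floor_correct[of "x * real b"] unfolding of_nat_Suc by linarith+
      qed
      have "x * real b < real b" using x b by simp
      with a(1) have "a < b" by linarith
      moreover have "x \<in> {real a / real b..<real (Suc a) / real b}"
        using a b by (simp add: pos_divide_le_eq pos_less_divide_eq)
      ultimately show "x \<in> (\<Union>a\<in>{0..<b}. {real a / real b..<real (Suc a) / real b})" by auto
    qed
    then show ?thesis
      using indicator_UN_disjoint[OF _ disj, of x, where ?'c = ennreal] by simp
  qed
  have "(\<Sum>a\<in>{0..<b}. \<integral>\<^sup>+x. G ((x + real a) / real b) * indicator {0..<1} x \<partial>lborel)
    = of_nat b * (\<integral>\<^sup>+x. (\<Sum>a\<in>{0..<b}. G x * indicator {real a / real b..<real (Suc a) / real b} x) \<partial>lborel)"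
    unfolding 1 by (subst nn_integral_sum) (auto simp: sum_distrib_left)
  then show ?thesis by (simp only: sum_distrib_left[symmetric] ind)
qed

lemma nn_integral_inverse_branches:
  fixes G :: "real \<Rightarrow> ennreal"
  assumes b: "b > 0" and G: "G \<in> borel_measurable borel"
  shows "(\<Sum>k\<in>words b q. \<integral>\<^sup>+x. G (xw b x k) * indicator {0..<1} x \<partial>lborel)
    = of_nat (b ^ q) * (\<integral>\<^sup>+x. G x * indicator {0..<1} x \<partial>lborel)"
proof (induction q)
  case (Suc q)
  note G[measurable]
  have "(\<Sum>k\<in>words b (Suc q). \<integral>\<^sup>+x. G (xw b x k) * indicator {0..<1} x \<partial>lborel)
      = (\<Sum>w\<in>words b q. \<Sum>a\<in>{0..<b}. \<integral>\<^sup>+x. G (xw b ((x + real a) / real b) w) * indicator {0..<1} x \<partial>lborel)"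
    unfolding sum_words_Suc xw_Cons[OF b] by (rule sum.swap)
  also have "\<dots> = (\<Sum>w\<in>words b q. of_nat b * (\<integral>\<^sup>+x. G (xw b x w) * indicator {0..<1} x \<partial>lborel))"
    by (intro sum.cong refl nn_integral_inverse_branches_1 b) measurable
  also have "\<dots> = of_nat (b ^ Suc q) * (\<integral>\<^sup>+x. G x * indicator {0..<1} x \<partial>lborel)"
    unfolding sum_distrib_left[symmetric] Suc.IH by (simp add: ac_simps)
  finally show ?case .
qed simp

section \<open>Regularity and self-similarity of S\<close>

locale skew_product =
  fixes b :: nat and \<gamma> :: real and \<psi> \<psi>' :: "real \<Rightarrow> real"
  assumes b: "b \<ge> 2"
    and \<gamma>: "1 / real b < \<gamma>" "\<gamma> < 1"
    and \<psi>_deriv: "\<And>x. (\<psi> has_real_derivative \<psi>' x) (at x)"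
    and \<psi>'_cont: "continuous_on UNIV \<psi>'"
    and \<psi>_per: "\<And>x. \<psi> (x + 1) = \<psi> x"
begin

abbreviation "P \<equiv> bernoulli b"
abbreviation "SS \<equiv> S b \<gamma> \<psi>"

lemma b_pos: "b > 0" using b by simp
lemma \<gamma>_pos: "\<gamma> > 0" using \<gamma>(1) b by (metis divide_pos_pos less_trans of_nat_0_less_iff b_pos zero_less_one)

lemma \<psi>_cont: "continuous_on UNIV \<psi>"
  using \<psi>_deriv by (meson DERIV_isCont continuous_at_imp_continuous_on)

lemma \<psi>'_per: "\<psi>' (x + 1) = \<psi>' x"
proof -
  have "((\<lambda>t. \<psi> (t + 1)) has_real_derivative \<psi>' (x + 1)) (at x)"
    using \<psi>_deriv[of "x + 1"] by (simp add: DERIV_shift)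
  then show ?thesis using \<psi>_deriv[of x] DERIV_unique by (simp add: \<psi>_per)
qed

lemma \<psi>_borel[measurable]: "\<psi> \<in> borel_measurable borel" "\<psi>' \<in> borel_measurable borel"
  using \<psi>_cont \<psi>'_cont by (auto intro: borel_measurable_continuous_onI)

definition shift_sum :: "(nat \<Rightarrow> nat) \<Rightarrow> nat \<Rightarrow> real" where
  "shift_sum i n = (\<Sum>k<Suc n. real (i k) * real b ^ k)"

text \<open>The termwise derivative of the series \<open>S\<close>. The explicit formula makes joint
  measurability and uniform estimates accessible, which \<open>deriv\<close> in \<open>S'\<close>
  does not.\<close>

definition S1 :: "real \<Rightarrow> (nat \<Rightarrow> nat) \<Rightarrow> real" where
  "S1 x i = (\<Sum>n. \<gamma> ^ n * (\<psi>' ((x + shift_sum i n) / real b ^ Suc n) / real b ^ Suc n))"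

lemma S_shift_sum: "SS x i = (\<Sum>n. \<gamma> ^ n * \<psi> ((x + shift_sum i n) / real b ^ Suc n))"
  by (simp add: S_def shift_sum_def)

lemma measurable_shift_sum[measurable (raw)]:
  assumes g: "g \<in> measurable M P"
  shows "(\<lambda>z. shift_sum (g z) n) \<in> borel_measurable M"
proof -
  have [measurable]: "(\<lambda>z. real (g z k)) \<in> borel_measurable M" for k
    using measurable_compose[OF measurable_compose[OF g measurable_coord], of real borel k] by simp
  show ?thesis unfolding shift_sum_def by measurable
qed

lemma measurable_S[measurable (raw)]:
  assumes [measurable]: "f \<in> borel_measurable M" "g \<in> measurable M P"
  shows "(\<lambda>z. SS (f z) (g z)) \<in> borel_measurable M"
  unfolding S_shift_sum by measurable

lemma measurable_S1[measurable (raw)]: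
  assumes [measurable]: "f \<in> borel_measurable M" "g \<in> measurable M P"
  shows "(\<lambda>z. S1 (f z) (g z)) \<in> borel_measurable M"
  unfolding S1_def by measurable

lemma summable_geometric_bounded:
  fixes a :: "nat \<Rightarrow> real"
  assumes "\<And>n. \<bar>a n\<bar> \<le> M"
  shows "summable (\<lambda>n. \<gamma> ^ n * a n)"
proof (rule summable_comparison_test)
  show "\<exists>N. \<forall>n\<ge>N. norm (\<gamma> ^ n * a n) \<le> M * \<gamma> ^ n"
    using assms \<gamma>_pos by (auto simp: abs_mult mult.commute intro!: mult_left_mono exI[of _ 0])
  show "summable (\<lambda>n. M * \<gamma> ^ n)"
    using \<gamma> \<gamma>_pos by (intro summable_mult summable_geometric) auto
qed

lemma summable_S: "summable (\<lambda>n. \<gamma> ^ n * \<psi> ((x + shift_sum i n) / real b ^ Suc n))"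
proof -
  obtain M where "\<And>x. \<bar>\<psi> x\<bar> \<le> M"
    using periodic_continuous_bounded[OF \<psi>_per \<psi>_cont] by blast
  then show ?thesis by (rule summable_geometric_bounded)
qed

lemma div_pow_le: "\<bar>y / real b ^ Suc n\<bar> \<le> \<bar>y\<bar>"
proof -
  have "1 \<le> real b ^ Suc n" using b by (intro one_le_power) auto
  then show ?thesis by (simp add: abs_divide divide_le_eq mult_le_cancel_left1 del: power_Suc) 
qed

lemma summable_S1: "summable (\<lambda>n. \<gamma> ^ n * (\<psi>' ((x + shift_sum i n) / real b ^ Suc n) / real b ^ Suc n))"
proof -
  obtain M where "\<And>x. \<bar>\<psi>' x\<bar> \<le> M"
    using periodic_continuous_bounded[OF \<psi>'_per \<psi>'_cont] by blast
  then show ?thesis by (rule summable_geometric_bounded[OF order_trans[OF div_pow_le]])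
qed

lemma S_has_derivative: "((\<lambda>t. SS t i) has_real_derivative S1 x i) (at x)"
proof -
  obtain M where M: "M > 0" "\<And>x. \<bar>\<psi>' x\<bar> \<le> M"
    using periodic_continuous_bounded[OF \<psi>'_per \<psi>'_cont] by blast
  show ?thesis
    unfolding S_shift_sum S1_def
  proof (rule has_field_derivative_series'(2)[where S = UNIV and ?x0.0 = 0])
    show "((\<lambda>t. \<gamma> ^ n * \<psi> ((t + shift_sum i n) / real b ^ Suc n)) has_real_derivative
        \<gamma> ^ n * (\<psi>' ((x + shift_sum i n) / real b ^ Suc n) / real b ^ Suc n)) (at x)" for n x
      using b_pos by (auto intro!: derivative_eq_intros DERIV_chain2[OF \<psi>_deriv] simp del: power_Suc)
    show "uniformly_convergent_on UNIV
      (\<lambda>n x. \<Sum>k<n. \<gamma> ^ k * (\<psi>' ((x + shift_sum i k) / real b ^ Suc k) / real b ^ Suc k))"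
    proof (rule Weierstrass_m_test')
      fix n x
      have "\<bar>\<psi>' ((x + shift_sum i n) / real b ^ Suc n) / real b ^ Suc n\<bar> \<le> M"
        using div_pow_le M(2) order_trans by blast
      then show "norm (\<gamma> ^ n * (\<psi>' ((x + shift_sum i n) / real b ^ Suc n) / real b ^ Suc n)) \<le> \<gamma> ^ n * M"
        unfolding real_norm_def abs_mult using \<gamma>_pos by (intro mult_mono) simp_all
      show "summable (\<lambda>n. \<gamma> ^ n * M)"
        using summable_geometric_bounded[of "\<lambda>_. M" M] M(1) by simp
    qed
  qed (use summable_S[of 0 i] in auto)
qed

lemma S'_eq: "S' b \<gamma> \<psi> x i = S1 x i"
  unfolding S'_def by (rule DERIV_imp_deriv[OF S_has_derivative])

text \<open>Division by powers of b only shrinks distances, so one modulus of continuity of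
  \<open>\<psi>'\<close> serves every term, and the weights are geometric. The point is that
  \<open>d\<close> does not depend on \<open>i\<close>: one cell length then works for all pairs of
  sequences in the transversality estimate.\<close>

lemma S1_equicontinuous:
  assumes e: "e > 0"
  obtains d where "d > 0" "\<And>x y i. \<bar>x - y\<bar> < d \<Longrightarrow> \<bar>S1 x i - S1 y i\<bar> < e"
proof -
  \<comment> \<open>The geometric series turns a termwise error \<open>\<eta>\<close> into
    \<open>\<eta> / (1 - \<gamma>)\<close>, which is \<open>e / 2\<close>.\<close>
  define \<eta> where "\<eta> = e * (1 - \<gamma>) / 2"
  have \<eta>: "\<eta> > 0" using e \<gamma> by (simp add: \<eta>_def)
  obtain d where d: "d > 0" "\<And>x y. \<bar>x - y\<bar> < d \<Longrightarrow> \<bar>\<psi>' x - \<psi>' y\<bar> < \<eta>"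
    using periodic_continuous_uniform[OF \<psi>'_per \<psi>'_cont \<eta>] by blast
  have "\<bar>S1 x i - S1 y i\<bar> < e" if xy: "\<bar>x - y\<bar> < d" for x y i
  proof -
    let ?t = "\<lambda>x n. \<psi>' ((x + shift_sum i n) / real b ^ Suc n) / real b ^ Suc n"
    have t: "\<bar>?t x n - ?t y n\<bar> \<le> \<eta>" for n
    proof -
      have "\<bar>(x + shift_sum i n) / real b ^ Suc n - (y + shift_sum i n) / real b ^ Suc n\<bar>
          = \<bar>(x - y) / real b ^ Suc n\<bar>"
        by (simp add: diff_divide_distrib[symmetric] del: power_Suc)
      also have "\<dots> < d" using div_pow_le[of "x - y" n] xy by linarith
      finally have "\<bar>\<psi>' ((x + shift_sum i n) / real b ^ Suc n) - \<psi>' ((y + shift_sum i n) / real b ^ Suc n)\<bar> < \<eta>"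
        by (rule d(2))
      moreover have "?t x n - ?t y n
          = (\<psi>' ((x + shift_sum i n) / real b ^ Suc n) - \<psi>' ((y + shift_sum i n) / real b ^ Suc n)) / real b ^ Suc n"
        by (rule diff_divide_distrib[symmetric])
      ultimately show ?thesis using div_pow_le by (metis less_imp_le order_trans)
    qed
    have "S1 x i - S1 y i = (\<Sum>n. \<gamma> ^ n * ?t x n - \<gamma> ^ n * ?t y n)"
      unfolding S1_def by (rule suminf_diff[OF summable_S1 summable_S1])
    also have "\<bar>\<dots>\<bar> \<le> (\<Sum>n. \<gamma> ^ n * \<eta>)"
    proof -
      have "norm (\<gamma> ^ n * ?t x n - \<gamma> ^ n * ?t y n) \<le> \<gamma> ^ n * \<eta>" for n
        unfolding right_diff_distrib[symmetric] real_norm_def abs_mult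
        using t[of n] \<gamma>_pos by (intro mult_mono) auto
      moreover have "summable (\<lambda>n. \<gamma> ^ n * \<eta>)"
        using summable_geometric_bounded[of "\<lambda>_. \<eta>" \<eta>] \<eta> by simp
      ultimately have "norm (\<Sum>n. \<gamma> ^ n * ?t x n - \<gamma> ^ n * ?t y n) \<le> (\<Sum>n. \<gamma> ^ n * \<eta>)"
        by (rule norm_suminf_le)
      then show ?thesis by simp
    qed
    also have "\<dots> = \<eta> / (1 - \<gamma>)"
      using \<gamma> \<gamma>_pos by (subst suminf_mult2[symmetric]) (auto simp: suminf_geometric)
    also have "\<dots> = e / 2"
    proof -
      have "e * c / 2 / c = e / 2" if "c \<noteq> 0" for c using that by simp
      from this[of "1 - \<gamma>"] show ?thesis using \<gamma> by (simp only: \<eta>_def)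
    qed
    also have "\<dots> < e" using e by simp
    finally show ?thesis .
  qed
  with d(1) that show ?thesis by blast
qed

text \<open>The first \<open>length k\<close> terms of the series see only the word k and form the
  constant; in the tail a factor b^q cancels and leaves the series at \<open>xw b x k\<close>. The
  value of \<open>c\<close> is hidden because only its independence of \<open>u\<close> matters:
  translations in y do not change the energy.\<close>

lemma S_concat_seq:
  "\<exists>c. \<forall>u. SS x (concat_seq k u) = c + \<gamma> ^ length k * SS (xw b x k) u"
proof -
  let ?q = "length k"
  define c where "c = (\<Sum>n<?q. \<gamma> ^ n * \<psi> ((x + (\<Sum>j<Suc n. real (k ! j) * real b ^ j)) / real b ^ Suc n))"
  have "SS x (concat_seq k u) = c + \<gamma> ^ ?q * SS (xw b x k) u" for u
  proof -
    have sh: "x + shift_sum (concat_seq k u) (n + ?q)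
        = real b ^ ?q * (xw b x k + shift_sum u n)" for n
    proof -
      have "shift_sum (concat_seq k u) (n + ?q) = (\<Sum>j<?q + Suc n. real (concat_seq k u j) * real b ^ j)"
        by (simp add: shift_sum_def add.commute)
      also have "\<dots> = (\<Sum>j<?q. real (k ! j) * real b ^ j) + (\<Sum>j<Suc n. real (u j) * real b ^ (?q + j))"
        unfolding sum_lessThan_add by (intro arg_cong2[of _ _ _ _ "(+)"] sum.cong) (auto simp: concat_seq_def)
      also have "\<dots> = (\<Sum>j<?q. real (k ! j) * real b ^ j) + real b ^ ?q * shift_sum u n"
        by (simp add: shift_sum_def sum_distrib_left power_add ac_simps distrib_left del: sum.lessThan_Suc)
      finally show ?thesis using b_pos by (simp add: xw_def field_simps)
    qed
    have "SS x (concat_seq k u)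
      = (\<Sum>n. \<gamma> ^ (n + ?q) * \<psi> ((x + shift_sum (concat_seq k u) (n + ?q)) / real b ^ Suc (n + ?q)))
        + (\<Sum>n<?q. \<gamma> ^ n * \<psi> ((x + shift_sum (concat_seq k u) n) / real b ^ Suc n))"
      unfolding S_shift_sum by (rule suminf_split_initial_segment[OF summable_S])
    also have "(\<Sum>n<?q. \<gamma> ^ n * \<psi> ((x + shift_sum (concat_seq k u) n) / real b ^ Suc n)) = c"
      unfolding c_def
    proof (intro sum.cong refl)
      fix n assume "n \<in> {..<?q}"
      then have "shift_sum (concat_seq k u) n = (\<Sum>j<Suc n. real (k ! j) * real b ^ j)"
        unfolding shift_sum_def by (intro sum.cong) (auto simp: concat_seq_def)
      then show "\<gamma> ^ n * \<psi> ((x + shift_sum (concat_seq k u) n) / real b ^ Suc n)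
          = \<gamma> ^ n * \<psi> ((x + (\<Sum>j<Suc n. real (k ! j) * real b ^ j)) / real b ^ Suc n)" by simp
    qed
    also have "(\<Sum>n. \<gamma> ^ (n + ?q) * \<psi> ((x + shift_sum (concat_seq k u) (n + ?q)) / real b ^ Suc (n + ?q)))
       = (\<Sum>n. \<gamma> ^ ?q * (\<gamma> ^ n * \<psi> ((xw b x k + shift_sum u n) / real b ^ Suc n)))"
    proof (intro suminf_cong)
      fix n
      have "(x + shift_sum (concat_seq k u) (n + ?q)) / real b ^ Suc (n + ?q) = (xw b x k + shift_sum u n) / real b ^ Suc n"
        unfolding sh using b_pos by (simp add: power_add)
      then show "\<gamma> ^ (n + ?q) * \<psi> ((x + shift_sum (concat_seq k u) (n + ?q)) / real b ^ Suc (n + ?q))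
          = \<gamma> ^ ?q * (\<gamma> ^ n * \<psi> ((xw b x k + shift_sum u n) / real b ^ Suc n))"
        by (simp add: power_add)
    qed
    also have "\<dots> = \<gamma> ^ ?q * SS (xw b x k) u"
      unfolding S_shift_sum by (rule suminf_mult[OF summable_S])
    finally show ?thesis by simp
  qed
  then show ?thesis by blast
qed

section \<open>Transversality and the energy recursion\<close>

sublocale P: prob_space P by (rule prob_space_bernoulli)
sublocale PP: pair_prob_space P P ..

definition ball_mass :: "real \<Rightarrow> real \<Rightarrow> real \<Rightarrow> real" where
  "ball_mass r x y = measure P {i. \<bar>SS x i - y\<bar> \<le> r}"

text \<open>A probability conditional on the initial word, not multiplied by b^(-q); hence the
  factor b^q in \<open>ball_mass_decomposition\<close>.\<close>

definition branch_mass :: "nat list \<Rightarrow> real \<Rightarrow> real \<Rightarrow> real \<Rightarrow> real" where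
  "branch_mass k r x y = measure P {u. \<bar>SS x (concat_seq k u) - y\<bar> \<le> r}"

definition transversal_mass :: "real \<Rightarrow> nat list \<Rightarrow> nat list \<Rightarrow> real \<Rightarrow> real \<Rightarrow> real \<Rightarrow> real" where
  "transversal_mass \<delta> k l r x y = measure (P \<Otimes>\<^sub>M P) {(u, v). \<bar>SS x (concat_seq k u) - y\<bar> \<le> r \<and>
     \<bar>SS x (concat_seq l v) - y\<bar> \<le> r \<and> \<bar>S1 x (concat_seq k u) - S1 x (concat_seq l v)\<bar> > \<delta>}"

definition energy :: "real \<Rightarrow> real \<Rightarrow> ennreal" where
  "energy r x = (\<integral>\<^sup>+y. ennreal ((ball_mass r x y)\<^sup>2) \<partial>lborel)"

lemma sets_P_Collect:
  assumes "Measurable.pred P Q"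
  shows "{i. Q i} \<in> sets P"
  using assms by (simp add: pred_def)

text \<open>An integral of a jointly measurable indicator gives measurability in both variables and
  access to Fubini, neither of which is visible from the measure of a set varying with x and
  y.\<close>

lemma ball_mass_eq_nn_integral: "ennreal (ball_mass r x y) = (\<integral>\<^sup>+i. indicator {-r..r} (SS x i - y) \<partial>P)"
proof -
  have "ennreal (ball_mass r x y) = emeasure P {i. \<bar>SS x i - y\<bar> \<le> r}"
    by (simp add: ball_mass_def P.emeasure_eq_measure)
  also have "\<dots> = (\<integral>\<^sup>+i. indicator {i. \<bar>SS x i - y\<bar> \<le> r} i \<partial>P)"
    by (rule nn_integral_indicator[symmetric], rule sets_P_Collect) measurable
  also have "\<dots> = (\<integral>\<^sup>+i. indicator {-r..r} (SS x i - y) \<partial>P)"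
    by (intro nn_integral_cong) (auto simp: indicator_def abs_le_iff)
  finally show ?thesis .
qed

lemma branch_mass_eq_nn_integral: "ennreal (branch_mass k r x y) = (\<integral>\<^sup>+u. indicator {-r..r} (SS x (concat_seq k u) - y) \<partial>P)"
proof -
  have "ennreal (branch_mass k r x y) = emeasure P {u. \<bar>SS x (concat_seq k u) - y\<bar> \<le> r}"
    by (simp add: branch_mass_def P.emeasure_eq_measure)
  also have "\<dots> = (\<integral>\<^sup>+u. indicator {u. \<bar>SS x (concat_seq k u) - y\<bar> \<le> r} u \<partial>P)"
    by (rule nn_integral_indicator[symmetric], rule sets_P_Collect) measurable
  also have "\<dots> = (\<integral>\<^sup>+u. indicator {-r..r} (SS x (concat_seq k u) - y) \<partial>P)"
    by (intro nn_integral_cong) (auto simp: indicator_def abs_le_iff)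
  finally show ?thesis .
qed

lemma measurable_ball_mass[measurable (raw)]:
  assumes [measurable]: "f \<in> borel_measurable M" "g \<in> borel_measurable M"
  shows "(\<lambda>z. ball_mass r (f z) (g z)) \<in> borel_measurable M"
proof -
  have "(\<lambda>z. enn2real (\<integral>\<^sup>+i. indicator {-r..r} (SS (f z) i - g z) \<partial>P)) \<in> borel_measurable M"
    by measurable
  then show ?thesis by (simp only: ball_mass_eq_nn_integral[symmetric] enn2real_ennreal ball_mass_def measure_nonneg)
qed

lemma measurable_branch_mass[measurable (raw)]:
  assumes [measurable]: "f \<in> borel_measurable M" "g \<in> borel_measurable M"
  shows "(\<lambda>z. branch_mass k r (f z) (g z)) \<in> borel_measurable M"
proof -
  have "(\<lambda>z. enn2real (\<integral>\<^sup>+u. indicator {-r..r} (SS (f z) (concat_seq k u) - g z) \<partial>P)) \<in> borel_measurable M"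
    by measurable
  then show ?thesis by (simp only: branch_mass_eq_nn_integral[symmetric] enn2real_ennreal branch_mass_def measure_nonneg)
qed

lemma measurable_energy[measurable]: "energy r \<in> borel_measurable borel"
  unfolding energy_def[abs_def] by measurable

lemma ball_mass_nonneg: "ball_mass r x y \<ge> 0" and ball_mass_le_1: "ball_mass r x y \<le> 1" and branch_mass_nonneg: "branch_mass k r x y \<ge> 0" and transversal_mass_nonneg: "transversal_mass \<delta> k l r x y \<ge> 0"
  by (auto simp: ball_mass_def branch_mass_def transversal_mass_def)

lemma ball_mass_decomposition: "real (b ^ q) * ball_mass r x y = (\<Sum>k\<in>words b q. branch_mass k r x y)"
proof -
  have "ennreal (real (b ^ q) * ball_mass r x y) = of_nat (b ^ q) * ennreal (ball_mass r x y)"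
    by (simp add: ennreal_mult ennreal_of_nat_eq_real_of_nat ball_mass_nonneg)
  also have "\<dots> = (\<Sum>k\<in>words b q. ennreal (branch_mass k r x y))"
    unfolding ball_mass_eq_nn_integral branch_mass_eq_nn_integral by (rule nn_integral_bernoulli_words[OF b_pos]) measurable
  also have "\<dots> = ennreal (\<Sum>k\<in>words b q. branch_mass k r x y)"
    by (simp add: branch_mass_nonneg)
  finally show ?thesis
    by (subst (asm) ennreal_inj) (auto simp: ball_mass_nonneg branch_mass_nonneg sum_nonneg)
qed

text \<open>The substitution \<open>c + \<gamma> ^ length k * y\<close> turns the branch mass at
  radius \<open>r\<close> into the ball mass over \<open>xw b x k\<close> at the rescaled radius.
  The factor in front is its Jacobian.\<close>

lemma nn_integral_branch_mass:
  "(\<integral>\<^sup>+y. ennreal ((branch_mass k r x y)\<^sup>2) \<partial>lborel) = ennreal (\<gamma> ^ length k) * energy (r / \<gamma> ^ length k) (xw b x k)"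
proof -
  let ?g = "\<gamma> ^ length k"
  have g: "?g > 0" using \<gamma>_pos by simp
  obtain c where c: "\<And>u. SS x (concat_seq k u) = c + ?g * SS (xw b x k) u"
    using S_concat_seq by blast
  have G: "branch_mass k r x (c + ?g * y) = ball_mass (r / ?g) (xw b x k) y" for y
  proof -
    have "\<bar>SS x (concat_seq k u) - (c + ?g * y)\<bar> \<le> r \<longleftrightarrow> \<bar>SS (xw b x k) u - y\<bar> \<le> r / ?g" for u
    proof -
      have "SS x (concat_seq k u) - (c + ?g * y) = ?g * (SS (xw b x k) u - y)"
        by (simp add: c algebra_simps)
      then have "\<bar>SS x (concat_seq k u) - (c + ?g * y)\<bar> = ?g * \<bar>SS (xw b x k) u - y\<bar>"
        using g by (simp add: abs_mult)
      then show ?thesis using g by (simp add: pos_le_divide_eq mult.commute)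
    qed
    then show ?thesis by (simp add: branch_mass_def ball_mass_def)
  qed
  have "(\<integral>\<^sup>+y. ennreal ((branch_mass k r x y)\<^sup>2) \<partial>lborel)
      = ennreal \<bar>?g\<bar> * (\<integral>\<^sup>+y. ennreal ((branch_mass k r x (c + ?g * y))\<^sup>2) \<partial>lborel)"
    using \<gamma>_pos by (intro nn_integral_real_affine) auto
  then show ?thesis using g by (simp only: G energy_def abs_of_pos)
qed

text \<open>Two points in the interval of radius \<open>r\<close> around y are at most 2r \<le>
  \<epsilon> apart, so a pair outside \<open>Eset\<close> can fail to be tangent only through its
  slopes. The product of masses is the product measure of a rectangle, all of whose points are
  therefore transversal.\<close>

lemma transversal_pair:
  assumes kl: "k \<in> words b q" "l \<in> words b q" "(k, l) \<notin> Eset b \<gamma> \<psi> q x \<epsilon> \<delta>" and r: "2 * r \<le> \<epsilon>"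
  shows "branch_mass k r x y * branch_mass l r x y \<le> transversal_mass \<delta> k l r x y"
proof -
  define A where "A k = {u. \<bar>SS x (concat_seq k u) - y\<bar> \<le> r}" for k
  have [measurable]: "A k \<in> sets P" for k
    unfolding A_def by (rule sets_P_Collect) measurable
  have [measurable]: "seqs b \<in> sets P"
  proof -
    have "Measurable.pred P (\<lambda>i. \<forall>n. i n < b)"
    proof (rule pred_intros_countable)
      fix n show "Measurable.pred P (\<lambda>i. i n < b)"
        by (rule measurable_compose[OF measurable_coord]) simp
    qed
    then show ?thesis unfolding seqs_def by (rule sets_P_Collect)
  qed
  \<comment> \<open>Non-membership in \<open>Eset\<close> says nothing about functions outside
    \<open>seqs b\<close>, so the rectangle is first cut down to them at no cost in measure.\<close>
  have G: "branch_mass k r x y = measure P (A k \<inter> seqs b)" for k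
    unfolding branch_mass_def A_def[symmetric]
    by (rule measure_eq_AE) (use AE_bernoulli_seqs[OF b_pos] in \<open>auto elim: eventually_mono\<close>)
  have "branch_mass k r x y * branch_mass l r x y = measure (P \<Otimes>\<^sub>M P) ((A k \<inter> seqs b) \<times> (A l \<inter> seqs b))"
    unfolding G by (simp add: measure_def P.emeasure_pair_measure_Times enn2real_mult)
  also have "\<dots> \<le> transversal_mass \<delta> k l r x y"
    unfolding transversal_mass_def
  proof (rule PP.P.finite_measure_mono)
    show "(A k \<inter> seqs b) \<times> (A l \<inter> seqs b) \<subseteq> {(u, v). \<bar>SS x (concat_seq k u) - y\<bar> \<le> r \<and>
     \<bar>SS x (concat_seq l v) - y\<bar> \<le> r \<and> \<bar>S1 x (concat_seq k u) - S1 x (concat_seq l v)\<bar> > \<delta>}"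
    proof clarify
      fix u v assume u: "u \<in> A k" "u \<in> seqs b" and v: "v \<in> A l" "v \<in> seqs b"
      have uv: "\<bar>SS x (concat_seq k u) - y\<bar> \<le> r" "\<bar>SS x (concat_seq l v) - y\<bar> \<le> r"
        using u v by (auto simp: A_def)
      then have "\<bar>SS x (concat_seq k u) - SS x (concat_seq l v)\<bar> \<le> \<epsilon>" using r by linarith
      moreover have "\<not> tangent b \<gamma> \<psi> \<epsilon> \<delta> x (concat_seq k u) (concat_seq l v)"
        using kl u v unfolding Eset_def by blast
      ultimately have "\<bar>S1 x (concat_seq k u) - S1 x (concat_seq l v)\<bar> > \<delta>"
        by (auto simp: tangent_def S'_eq)
      with uv show "\<bar>SS x (concat_seq k u) - y\<bar> \<le> r \<and> \<bar>SS x (concat_seq l v) - y\<bar> \<le> r \<and>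
         \<bar>S1 x (concat_seq k u) - S1 x (concat_seq l v)\<bar> > \<delta>" by blast
    qed
    have "Measurable.pred (P \<Otimes>\<^sub>M P) (\<lambda>(u, v). \<bar>SS x (concat_seq k u) - y\<bar> \<le> r \<and>
     \<bar>SS x (concat_seq l v) - y\<bar> \<le> r \<and> \<bar>S1 x (concat_seq k u) - S1 x (concat_seq l v)\<bar> > \<delta>)"
      by measurable
    then show "{(u, v). \<bar>SS x (concat_seq k u) - y\<bar> \<le> r \<and>
     \<bar>SS x (concat_seq l v) - y\<bar> \<le> r \<and> \<bar>S1 x (concat_seq k u) - S1 x (concat_seq l v)\<bar> > \<delta>} \<in> sets (P \<Otimes>\<^sub>M P)"
      by (simp add: pred_def space_pair_measure)
  qed
  finally show ?thesis .
qed

text \<open>After expanding the square into pairs of words, each pair is bounded by weighted AM-GM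
  if it is tangent and by its transversal mass otherwise. Adding both bounds to every pair avoids
  splitting the sum along a set that depends on x.\<close>

lemma ball_mass_square_le:
  assumes V: "\<And>u v. u \<in> words b q \<Longrightarrow> v \<in> words b q \<Longrightarrow> V u v \<ge> 0"
    and E: "\<And>u v. (u, v) \<in> Eset b \<gamma> \<psi> q x \<epsilon> \<delta> \<Longrightarrow> V u v * V v u \<ge> (1::real)"
    and r: "2 * r \<le> \<epsilon>"
  shows "(real (b ^ q) * ball_mass r x y)\<^sup>2 \<le> (\<Sum>k\<in>words b q. (\<Sum>l\<in>words b q. V k l) * (branch_mass k r x y)\<^sup>2)
    + (\<Sum>k\<in>words b q. \<Sum>l\<in>words b q. transversal_mass \<delta> k l r x y)"
proof -
  let ?W = "words b q"
  let ?G = "\<lambda>k. branch_mass k r x y" and ?T = "\<lambda>k l. transversal_mass \<delta> k l r x y"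
  have pair: "?G k * ?G l \<le> (V k l * (?G k)\<^sup>2 + V l k * (?G l)\<^sup>2) / 2 + ?T k l"
    if k: "k \<in> ?W" and l: "l \<in> ?W" for k l
  proof (cases "(k, l) \<in> Eset b \<gamma> \<psi> q x \<epsilon> \<delta>")
    case True
    then show ?thesis
      using weighted_AM_GM[OF V[OF k l] V[OF l k] E[OF True] branch_mass_nonneg[of k r x y] branch_mass_nonneg[of l r x y]]
        transversal_mass_nonneg[of \<delta> k l r x y] by linarith
  next
    case False
    have "0 \<le> (V k l * (?G k)\<^sup>2 + V l k * (?G l)\<^sup>2) / 2"
      using V k l by simp
    with transversal_pair[OF k l False r, of y] show ?thesis by linarith
  qed
  have "(real (b ^ q) * ball_mass r x y)\<^sup>2 = (\<Sum>k\<in>?W. \<Sum>l\<in>?W. ?G k * ?G l)"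
    unfolding ball_mass_decomposition power2_eq_square sum_product ..
  also have "\<dots> \<le> (\<Sum>k\<in>?W. \<Sum>l\<in>?W. (V k l * (?G k)\<^sup>2 + V l k * (?G l)\<^sup>2) / 2 + ?T k l)"
    by (intro sum_mono pair)
  also have "\<dots> = ((\<Sum>k\<in>?W. \<Sum>l\<in>?W. V k l * (?G k)\<^sup>2) + (\<Sum>k\<in>?W. \<Sum>l\<in>?W. V l k * (?G l)\<^sup>2)) / 2
      + (\<Sum>k\<in>?W. \<Sum>l\<in>?W. ?T k l)"
    by (simp only: sum.distrib sum_divide_distrib[symmetric])
  \<comment> \<open>The two halves of the AM-GM bound agree after exchanging k and l, so only the
    row sums of V survive, as in the definition of \<Sigma>.\<close>
  also have "(\<Sum>k\<in>?W. \<Sum>l\<in>?W. V l k * (?G l)\<^sup>2) = (\<Sum>k\<in>?W. \<Sum>l\<in>?W. V k l * (?G k)\<^sup>2)"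
    by (rule sum.swap)
  finally show ?thesis by (simp add: sum_distrib_right)
qed

lemma transversal_mass_eq_nn_integral:
  "ennreal (transversal_mass \<delta> k l r x y) = (\<integral>\<^sup>+p. of_bool (\<bar>SS x (concat_seq k (fst p)) - y\<bar> \<le> r \<and>
     \<bar>SS x (concat_seq l (snd p)) - y\<bar> \<le> r \<and> \<bar>S1 x (concat_seq k (fst p)) - S1 x (concat_seq l (snd p))\<bar> > \<delta>) \<partial>(P \<Otimes>\<^sub>M P))"
proof -
  let ?Q = "\<lambda>p. \<bar>SS x (concat_seq k (fst p)) - y\<bar> \<le> r \<and>
     \<bar>SS x (concat_seq l (snd p)) - y\<bar> \<le> r \<and> \<bar>S1 x (concat_seq k (fst p)) - S1 x (concat_seq l (snd p))\<bar> > \<delta>"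
  have "Measurable.pred (P \<Otimes>\<^sub>M P) ?Q" by measurable
  then have "{p. ?Q p} \<in> sets (P \<Otimes>\<^sub>M P)" by (simp add: pred_def space_pair_measure)
  then have "(\<integral>\<^sup>+p. indicator {p. ?Q p} p \<partial>(P \<Otimes>\<^sub>M P)) = emeasure (P \<Otimes>\<^sub>M P) {p. ?Q p}"
    by (rule nn_integral_indicator)
  moreover have "ennreal (transversal_mass \<delta> k l r x y) = emeasure (P \<Otimes>\<^sub>M P) {p. ?Q p}"
    by (simp add: transversal_mass_def PP.P.emeasure_eq_measure case_prod_unfold)
  ultimately show ?thesis
    by (simp only: indicator_def mem_Collect_eq)
qed

text \<open>For a fixed pair of sequences, y ranges over an interval of length at most 2r and exists
  only if the two graphs are within 2r at x; by transversality such x form a set of measure at most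
  16Nr/\<delta>. The product is quadratic in r with constant 32N/\<delta>, uniformly in the
  sequences, so Fubini applies.\<close>

lemma nn_integral_transversal_mass_le:
  assumes \<delta>: "\<delta> > 0"
  obtains C where "C \<ge> 0" "\<And>k l r. r > 0 \<Longrightarrow>
    (\<integral>\<^sup>+x. (\<integral>\<^sup>+y. ennreal (transversal_mass \<delta> k l r x y) \<partial>lborel) * indicator {0..<1} x \<partial>lborel) \<le> ennreal (C * r\<^sup>2)"
proof -
  \<comment> \<open>A quarter of \<delta> for each of the two slopes keeps the variation of their
    difference below \<delta>/2 on a cell of length 1/N.\<close>
  obtain d where d: "d > 0" "\<And>x y i. \<bar>x - y\<bar> < d \<Longrightarrow> \<bar>S1 x i - S1 y i\<bar> < \<delta> / 4"
    using S1_equicontinuous[of "\<delta> / 4"] \<delta> by auto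
  obtain N where N: "N > 0" "1 / real N < d"
    using d(1) by (metis nat_approx_posE zero_less_Suc)
  define C where "C = 32 * real N / \<delta>"
  show ?thesis
  proof (rule that[of C])
    show "C \<ge> 0" using \<delta> by (simp add: C_def)
    fix k l and r :: real assume r: "r > 0"
    let ?h = "\<lambda>p x. SS x (concat_seq k (fst p)) - SS x (concat_seq l (snd p))"
    let ?h' = "\<lambda>p x. S1 x (concat_seq k (fst p)) - S1 x (concat_seq l (snd p))"
    let ?Q = "\<lambda>x y p. \<bar>SS x (concat_seq k (fst p)) - y\<bar> \<le> r \<and>
     \<bar>SS x (concat_seq l (snd p)) - y\<bar> \<le> r \<and> \<bar>?h' p x\<bar> > \<delta>"
    have y_int: "(\<integral>\<^sup>+y. of_bool (?Q x y p) \<partial>lborel) \<le> ennreal (2 * r) * of_bool (\<bar>?h p x\<bar> \<le> 2 * r \<and> \<bar>?h' p x\<bar> > \<delta>)" for x p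
    proof (cases "\<bar>?h p x\<bar> \<le> 2 * r \<and> \<bar>?h' p x\<bar> > \<delta>")
      case True
      let ?s = "SS x (concat_seq k (fst p))"
      have "(\<integral>\<^sup>+y. of_bool (?Q x y p) \<partial>lborel) \<le> (\<integral>\<^sup>+y. indicator {?s - r..?s + r} y \<partial>lborel)"
        by (intro nn_integral_mono) (auto simp: indicator_def abs_le_iff)
      also have "\<dots> = ennreal (2 * r)" using r by simp
      finally show ?thesis by (simp only: True of_bool_eq(2) simp_thms mult_1_right)
    next
      case False
      then have "of_bool (?Q x y p) = (0 :: ennreal)" for y by (auto simp: abs_le_iff)
      then show ?thesis by (simp only: nn_integral_const) simp
    qed
    have x_int: "(\<integral>\<^sup>+x. of_bool (\<bar>?h p x\<bar> \<le> 2 * r \<and> \<bar>?h' p x\<bar> > \<delta>) * indicator {0..<1} x \<partial>lborel)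
        \<le> ennreal (16 * real N * r / \<delta>)" for p
    proof -
      have "(\<integral>\<^sup>+x. of_bool (\<bar>?h p x\<bar> \<le> 2 * r \<and> \<bar>?h' p x\<bar> > \<delta>) * indicator {0..<1} x \<partial>lborel)
        = (\<integral>\<^sup>+x. indicator {x \<in> {0..<1}. \<bar>?h p x\<bar> \<le> 2 * r \<and> \<bar>?h' p x\<bar> > \<delta>} x \<partial>lborel)"
        by (intro nn_integral_cong) (auto simp: indicator_def)
      also have "\<dots> = emeasure lborel {x \<in> {0..<1}. \<bar>?h p x\<bar> \<le> 2 * r \<and> \<bar>?h' p x\<bar> > \<delta>}"
      proof (rule nn_integral_indicator)
        have "Measurable.pred borel (\<lambda>x. x \<in> {0..<1} \<and> \<bar>?h p x\<bar> \<le> 2 * r \<and> \<bar>?h' p x\<bar> > \<delta>)"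
          by measurable
        then show "{x \<in> {0..<1}. \<bar>?h p x\<bar> \<le> 2 * r \<and> \<bar>?h' p x\<bar> > \<delta>} \<in> sets lborel"
          by (simp add: pred_def)
      qed
      also have "\<dots> \<le> ennreal (8 * real N * (2 * r) / \<delta>)"
      proof (rule emeasure_transversal_sublevel)
        show "(?h p has_real_derivative ?h' p x) (at x)" for x
          by (intro DERIV_diff S_has_derivative)
        show "\<bar>?h' p x - ?h' p y\<bar> < \<delta> / 2" if "\<bar>x - y\<bar> < 1 / real N" for x y
          using d(2)[of x y "concat_seq k (fst p)"] d(2)[of x y "concat_seq l (snd p)"] that N by linarith
      qed (use N \<delta> r in auto)
      finally show ?thesis by (simp add: mult.assoc)
    qed
    have "(\<integral>\<^sup>+x. (\<integral>\<^sup>+y. ennreal (transversal_mass \<delta> k l r x y) \<partial>lborel) * indicator {0..<1} x \<partial>lborel)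
      = (\<integral>\<^sup>+x. (\<integral>\<^sup>+p. (\<integral>\<^sup>+y. of_bool (?Q x y p) \<partial>lborel) \<partial>(P \<Otimes>\<^sub>M P)) * indicator {0..<1} x \<partial>lborel)"
    proof -
      interpret pair_sigma_finite "P \<Otimes>\<^sub>M P" lborel ..
      have "(\<integral>\<^sup>+y. ennreal (transversal_mass \<delta> k l r x y) \<partial>lborel) = (\<integral>\<^sup>+p. (\<integral>\<^sup>+y. of_bool (?Q x y p) \<partial>lborel) \<partial>(P \<Otimes>\<^sub>M P))" for x
        unfolding transversal_mass_eq_nn_integral by (rule Fubini') measurable
      then show ?thesis by simp
    qed
    also have "\<dots> \<le> (\<integral>\<^sup>+x. (\<integral>\<^sup>+p. ennreal (2 * r) * of_bool (\<bar>?h p x\<bar> \<le> 2 * r \<and> \<bar>?h' p x\<bar> > \<delta>) \<partial>(P \<Otimes>\<^sub>M P)) * indicator {0..<1} x \<partial>lborel)"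
      by (intro nn_integral_mono mult_right_mono y_int) auto
    also have "\<dots> = (\<integral>\<^sup>+x. (\<integral>\<^sup>+p. ennreal (2 * r) * (of_bool (\<bar>?h p x\<bar> \<le> 2 * r \<and> \<bar>?h' p x\<bar> > \<delta>) * indicator {0..<1} x) \<partial>(P \<Otimes>\<^sub>M P)) \<partial>lborel)"
      by (subst nn_integral_multc[symmetric]) (auto simp: mult.assoc)
    also have "\<dots> = (\<integral>\<^sup>+p. (\<integral>\<^sup>+x. ennreal (2 * r) * (of_bool (\<bar>?h p x\<bar> \<le> 2 * r \<and> \<bar>?h' p x\<bar> > \<delta>) * indicator {0..<1} x) \<partial>lborel) \<partial>(P \<Otimes>\<^sub>M P))"
    proof -
      interpret pair_sigma_finite "P \<Otimes>\<^sub>M P" lborel ..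
      show ?thesis by (rule Fubini') measurable
    qed
    also have "\<dots> = (\<integral>\<^sup>+p. ennreal (2 * r) * (\<integral>\<^sup>+x. of_bool (\<bar>?h p x\<bar> \<le> 2 * r \<and> \<bar>?h' p x\<bar> > \<delta>) * indicator {0..<1} x \<partial>lborel) \<partial>(P \<Otimes>\<^sub>M P))"
      by (intro nn_integral_cong nn_integral_cmult) measurable
    also have "\<dots> \<le> (\<integral>\<^sup>+p. ennreal (2 * r) * ennreal (16 * real N * r / \<delta>) \<partial>(P \<Otimes>\<^sub>M P))"
      by (intro nn_integral_mono mult_left_mono x_int) auto
    also have "\<dots> = ennreal (2 * r) * ennreal (16 * real N * r / \<delta>)"
      by (simp add: PP.P.emeasure_space_1)
    also have "\<dots> = ennreal (C * r\<^sup>2)"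
      using r \<delta> by (subst ennreal_mult[symmetric]) (auto simp: C_def power2_eq_square)
    finally show "(\<integral>\<^sup>+x. (\<integral>\<^sup>+y. ennreal (transversal_mass \<delta> k l r x y) \<partial>lborel) * indicator {0..<1} x \<partial>lborel) \<le> ennreal (C * r\<^sup>2)" .
  qed
qed

lemma measurable_transversal_mass[measurable]:
  "(\<lambda>x. \<integral>\<^sup>+y. ennreal (transversal_mass \<delta> k l r x y) \<partial>lborel) \<in> borel_measurable borel"
  unfolding transversal_mass_eq_nn_integral by measurable

lemma measurable_transversal_mass_slice[measurable]: "(\<lambda>y. transversal_mass \<delta> k l r x y) \<in> borel_measurable borel"
proof -
  have "(\<lambda>y. enn2real (\<integral>\<^sup>+p. of_bool (\<bar>SS x (concat_seq k (fst p)) - y\<bar> \<le> r \<and>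
     \<bar>SS x (concat_seq l (snd p)) - y\<bar> \<le> r \<and> \<bar>S1 x (concat_seq k (fst p)) - S1 x (concat_seq l (snd p))\<bar> > \<delta>)
      \<partial>(P \<Otimes>\<^sub>M P))) \<in> borel_measurable borel"
    by measurable
  then show ?thesis by (simp only: transversal_mass_eq_nn_integral[symmetric] enn2real_ennreal transversal_mass_nonneg)
qed

section \<open>Weighted energy and its iteration over scales\<close>

definition weighted_energy :: "(real \<Rightarrow> real) \<Rightarrow> real \<Rightarrow> ennreal" where
  "weighted_energy \<omega> r = (\<integral>\<^sup>+x. ennreal (\<omega> x) * energy r x * indicator {0..<1} x \<partial>lborel)"

text \<open>The trivial bound that starts the iteration: a mass is at most 1, so its square is at
  most itself, and by Fubini the masses integrate to the length of the interval.\<close>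

lemma energy_le: "r \<ge> 0 \<Longrightarrow> energy r x \<le> ennreal (2 * r)"
proof -
  assume r: "r \<ge> 0"
  have "energy r x \<le> (\<integral>\<^sup>+y. ennreal (ball_mass r x y) \<partial>lborel)"
    unfolding energy_def power2_eq_square
    by (intro nn_integral_mono ennreal_leI mult_left_le ball_mass_le_1 ball_mass_nonneg)
  also have "\<dots> = (\<integral>\<^sup>+y. \<integral>\<^sup>+i. indicator {-r..r} (SS x i - y) \<partial>P \<partial>lborel)"
    unfolding ball_mass_eq_nn_integral ..
  also have "\<dots> = (\<integral>\<^sup>+i. \<integral>\<^sup>+y. indicator {-r..r} (SS x i - y) \<partial>lborel \<partial>P)"
  proof -
    interpret pair_sigma_finite P lborel ..
    show ?thesis by (rule Fubini') measurable
  qed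
  also have "\<dots> = (\<integral>\<^sup>+i. \<integral>\<^sup>+y. indicator {SS x i - r..SS x i + r} y \<partial>lborel \<partial>P)"
    by (intro nn_integral_cong) (auto simp: indicator_def)
  also have "\<dots> = ennreal (2 * r)"
    using r P.emeasure_space_1 by simp
  finally show ?thesis .
qed

text \<open>Multiply the pointwise square bound by \<omega>(x). The hypothesis on
  \<open>\<Lambda>\<close> moves the weight from x to x(k), so each branch term becomes the weighted
  energy density at x(k), and summing over the inverse branches reassembles the integral over [0,1)
  with a factor b^q. The transversal terms cost only the upper bound \<open>W\<close> of the
  weight.\<close>

lemma energy_recursion:
  fixes \<omega> :: "real \<Rightarrow> real"
  assumes \<omega>[measurable]: "\<omega> \<in> borel_measurable borel"
    and \<omega>_nonneg: "\<And>x. x \<in> {0..<1} \<Longrightarrow> \<omega> x \<ge> 0"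
    and V: "\<And>x u v. x \<in> {0..<1} \<Longrightarrow> u \<in> words b q \<Longrightarrow> v \<in> words b q \<Longrightarrow> V x u v \<ge> 0"
    and E: "\<And>x u v. x \<in> {0..<1} \<Longrightarrow> (u, v) \<in> Eset b \<gamma> \<psi> q x \<epsilon> \<delta> \<Longrightarrow> V x u v * V x v u \<ge> (1::real)"
    and \<delta>: "\<delta> > 0"
    and \<Lambda>: "\<Lambda> \<ge> 0" "AE x in lborel. x \<in> {0..<1} \<longrightarrow> (\<forall>k\<in>words b q. \<omega> x * (\<Sum>l\<in>words b q. V x k l) \<le> \<Lambda> * \<omega> (xw b x k))"
    and W: "W \<ge> 0" "AE x in lborel. x \<in> {0..<1} \<longrightarrow> \<omega> x \<le> W"
  obtains C where "C \<ge> 0" "\<And>r. r > 0 \<Longrightarrow> 2 * r \<le> \<epsilon> \<Longrightarrow>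
    ennreal ((real (b ^ q))\<^sup>2) * weighted_energy \<omega> r \<le> ennreal (\<Lambda> * \<gamma> ^ q * real (b ^ q)) * weighted_energy \<omega> (r / \<gamma> ^ q) + ennreal (C * r\<^sup>2)"
proof -
  let ?W = "words b q"
  obtain C where C: "C \<ge> 0" "\<And>k l r. r > 0 \<Longrightarrow>
    (\<integral>\<^sup>+x. (\<integral>\<^sup>+y. ennreal (transversal_mass \<delta> k l r x y) \<partial>lborel) * indicator {0..<1} x \<partial>lborel) \<le> ennreal (C * r\<^sup>2)"
    using nn_integral_transversal_mass_le[OF \<delta>] by blast
  \<comment> \<open>One transversal constant \<open>C\<close> for every pair of words, times the
    bound on the weight.\<close>
  define C' where "C' = W * (real (card ?W) * (real (card ?W) * C))"
  show ?thesis
  proof (rule that[of C'])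
    show "C' \<ge> 0" using C W by (simp add: C'_def)
    fix r :: real assume r: "r > 0" "2 * r \<le> \<epsilon>"
    define \<tau> where "\<tau> k l x = (\<integral>\<^sup>+y. ennreal (transversal_mass \<delta> k l r x y) \<partial>lborel)" for k l x
    define h where "h x = ennreal (\<omega> x) * energy (r / \<gamma> ^ q) x" for x
    have [measurable]: "\<tau> k l \<in> borel_measurable borel" for k l
      unfolding \<tau>_def[abs_def] by measurable
    have [measurable]: "h \<in> borel_measurable borel"
      unfolding h_def[abs_def] by measurable
    have pointwise: "ennreal ((real (b ^ q))\<^sup>2) * (ennreal (\<omega> x) * energy r x)
        \<le> ennreal (\<Lambda> * \<gamma> ^ q) * (\<Sum>k\<in>?W. h (xw b x k)) + ennreal W * (\<Sum>k\<in>?W. \<Sum>l\<in>?W. \<tau> k l x)"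
      if x: "x \<in> {0..<1}" and wV: "\<And>k. k \<in> ?W \<Longrightarrow> \<omega> x * (\<Sum>l\<in>?W. V x k l) \<le> \<Lambda> * \<omega> (xw b x k)"
        and wW: "\<omega> x \<le> W" for x
    proof -
      define Vk where "Vk k = (\<Sum>l\<in>?W. V x k l)" for k
      have Vk: "Vk k \<ge> 0" if "k \<in> ?W" for k
        unfolding Vk_def using V x that by (intro sum_nonneg) auto
      have "ennreal ((real (b ^ q))\<^sup>2) * energy r x = (\<integral>\<^sup>+y. ennreal ((real (b ^ q) * ball_mass r x y)\<^sup>2) \<partial>lborel)"
        unfolding energy_def power_mult_distrib by (simp add: ennreal_mult nn_integral_cmult)
      also have "\<dots> \<le> (\<integral>\<^sup>+y. ennreal ((\<Sum>k\<in>?W. Vk k * (branch_mass k r x y)\<^sup>2) + (\<Sum>k\<in>?W. \<Sum>l\<in>?W. transversal_mass \<delta> k l r x y)) \<partial>lborel)"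
        unfolding Vk_def using V[OF x] E[OF x] r by (intro nn_integral_mono ennreal_leI ball_mass_square_le) auto
      also have "\<dots> = (\<integral>\<^sup>+y. (\<Sum>k\<in>?W. ennreal (Vk k) * ennreal ((branch_mass k r x y)\<^sup>2)) + (\<Sum>k\<in>?W. \<Sum>l\<in>?W. ennreal (transversal_mass \<delta> k l r x y)) \<partial>lborel)"
        using Vk by (intro nn_integral_cong)
          (simp add: ennreal_plus sum_nonneg transversal_mass_nonneg ennreal_mult[symmetric] sum_ennreal)
      also have "\<dots> = (\<Sum>k\<in>?W. ennreal (Vk k) * (\<integral>\<^sup>+y. ennreal ((branch_mass k r x y)\<^sup>2) \<partial>lborel)) + (\<Sum>k\<in>?W. \<Sum>l\<in>?W. \<tau> k l x)"
        unfolding \<tau>_def by (simp add: nn_integral_add nn_integral_sum nn_integral_cmult)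
      also have "\<dots> = (\<Sum>k\<in>?W. ennreal (Vk k) * (ennreal (\<gamma> ^ q) * energy (r / \<gamma> ^ q) (xw b x k))) + (\<Sum>k\<in>?W. \<Sum>l\<in>?W. \<tau> k l x)"
        unfolding nn_integral_branch_mass by (intro arg_cong2[of _ _ _ _ "(+)"] sum.cong refl) (simp add: words_def)
      finally have "ennreal (\<omega> x) * (ennreal ((real (b ^ q))\<^sup>2) * energy r x)
        \<le> ennreal (\<omega> x) * ((\<Sum>k\<in>?W. ennreal (Vk k) * (ennreal (\<gamma> ^ q) * energy (r / \<gamma> ^ q) (xw b x k))) + (\<Sum>k\<in>?W. \<Sum>l\<in>?W. \<tau> k l x))"
        by (rule mult_left_mono) simp
      also have "\<dots> = (\<Sum>k\<in>?W. (ennreal (\<omega> x) * ennreal (Vk k)) * (ennreal (\<gamma> ^ q) * energy (r / \<gamma> ^ q) (xw b x k)))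
          + ennreal (\<omega> x) * (\<Sum>k\<in>?W. \<Sum>l\<in>?W. \<tau> k l x)"
        by (simp only: distrib_left sum_distrib_left mult.assoc)
      also have "\<dots> \<le> (\<Sum>k\<in>?W. (ennreal \<Lambda> * ennreal (\<omega> (xw b x k))) * (ennreal (\<gamma> ^ q) * energy (r / \<gamma> ^ q) (xw b x k)))
          + ennreal W * (\<Sum>k\<in>?W. \<Sum>l\<in>?W. \<tau> k l x)"
      \<comment> \<open>Here the weight changes its base point from x to x(k).\<close>
      proof (intro add_mono sum_mono mult_right_mono)
        fix k assume k: "k \<in> ?W"
        have "ennreal (\<omega> x) * ennreal (Vk k) = ennreal (\<omega> x * Vk k)"
          using \<omega>_nonneg[OF x] Vk[OF k] by (simp add: ennreal_mult)
        also have "\<dots> \<le> ennreal (\<Lambda> * \<omega> (xw b x k))"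
          using wV[OF k] by (simp add: Vk_def ennreal_leI)
        also have "\<dots> = ennreal \<Lambda> * ennreal (\<omega> (xw b x k))"
          using \<Lambda> \<omega>_nonneg[OF xw_in_unit[OF b_pos x k]] by (simp add: ennreal_mult)
        finally show "ennreal (\<omega> x) * ennreal (Vk k) \<le> ennreal \<Lambda> * ennreal (\<omega> (xw b x k))" .
      qed (use wW in \<open>auto intro: ennreal_leI\<close>)
      also have "(\<Sum>k\<in>?W. (ennreal \<Lambda> * ennreal (\<omega> (xw b x k))) * (ennreal (\<gamma> ^ q) * energy (r / \<gamma> ^ q) (xw b x k)))
          = ennreal (\<Lambda> * \<gamma> ^ q) * (\<Sum>k\<in>?W. h (xw b x k))"
        using \<Lambda> \<gamma>_pos by (simp add: h_def sum_distrib_left ennreal_mult ac_simps)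
      finally show ?thesis by (simp only: ac_simps)
    qed
    have "ennreal ((real (b ^ q))\<^sup>2) * weighted_energy \<omega> r
        = (\<integral>\<^sup>+x. ennreal ((real (b ^ q))\<^sup>2) * (ennreal (\<omega> x) * energy r x) * indicator {0..<1} x \<partial>lborel)"
      unfolding weighted_energy_def by (subst nn_integral_cmult[symmetric]) (auto simp: mult.assoc)
    also have "\<dots> \<le> (\<integral>\<^sup>+x. ennreal (\<Lambda> * \<gamma> ^ q) * (\<Sum>k\<in>?W. h (xw b x k) * indicator {0..<1} x)
        + ennreal W * (\<Sum>k\<in>?W. \<Sum>l\<in>?W. \<tau> k l x * indicator {0..<1} x) \<partial>lborel)"
    proof (rule nn_integral_mono_AE)
      show "AE x in lborel. ennreal ((real (b ^ q))\<^sup>2) * (ennreal (\<omega> x) * energy r x) * indicator {0..<1} x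
        \<le> ennreal (\<Lambda> * \<gamma> ^ q) * (\<Sum>k\<in>?W. h (xw b x k) * indicator {0..<1} x)
        + ennreal W * (\<Sum>k\<in>?W. \<Sum>l\<in>?W. \<tau> k l x * indicator {0..<1} x)"
        using \<Lambda>(2) W(2)
      proof eventually_elim
        case (elim x)
        show ?case
        proof (cases "x \<in> {0..<1}")
          case True
          with pointwise[of x] elim show ?thesis by simp
        qed simp
      qed
    qed
    also have "\<dots> = ennreal (\<Lambda> * \<gamma> ^ q) * (\<Sum>k\<in>?W. \<integral>\<^sup>+x. h (xw b x k) * indicator {0..<1} x \<partial>lborel)
        + ennreal W * (\<Sum>k\<in>?W. \<Sum>l\<in>?W. \<integral>\<^sup>+x. \<tau> k l x * indicator {0..<1} x \<partial>lborel)"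
    proof -
      have "(\<integral>\<^sup>+x. c * (\<Sum>k\<in>?W. f k x) + d * (\<Sum>k\<in>?W. \<Sum>l\<in>?W. g k l x) \<partial>lborel)
          = c * (\<Sum>k\<in>?W. \<integral>\<^sup>+x. f k x \<partial>lborel) + d * (\<Sum>k\<in>?W. \<Sum>l\<in>?W. \<integral>\<^sup>+x. g k l x \<partial>lborel)"
        if [measurable]: "\<And>k. f k \<in> borel_measurable borel" "\<And>k l. g k l \<in> borel_measurable borel"
        for c d and f :: "nat list \<Rightarrow> real \<Rightarrow> ennreal" and g
        by (simp add: nn_integral_add nn_integral_sum nn_integral_cmult)
      then show ?thesis by this measurable
    qed
    also have "(\<Sum>k\<in>?W. \<integral>\<^sup>+x. h (xw b x k) * indicator {0..<1} x \<partial>lborel) = of_nat (b ^ q) * weighted_energy \<omega> (r / \<gamma> ^ q)"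
      unfolding weighted_energy_def h_def[symmetric] by (rule nn_integral_inverse_branches[OF b_pos]) measurable
    also have "ennreal W * (\<Sum>k\<in>?W. \<Sum>l\<in>?W. \<integral>\<^sup>+x. \<tau> k l x * indicator {0..<1} x \<partial>lborel)
        \<le> ennreal W * (\<Sum>k\<in>?W. \<Sum>l\<in>?W. ennreal (C * r\<^sup>2))"
      unfolding \<tau>_def by (intro mult_left_mono sum_mono C(2) r) auto
    also have "\<dots> = ennreal (C' * r\<^sup>2)"
      using W C by (simp add: C'_def ennreal_of_nat_eq_real_of_nat ennreal_mult[symmetric] ac_simps)
    finally show "ennreal ((real (b ^ q))\<^sup>2) * weighted_energy \<omega> r \<le> ennreal (\<Lambda> * \<gamma> ^ q * real (b ^ q)) * weighted_energy \<omega> (r / \<gamma> ^ q) + ennreal (C' * r\<^sup>2)"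
      using \<Lambda> \<gamma>_pos by (simp add: ennreal_mult ennreal_of_nat_eq_real_of_nat ac_simps)
  qed
qed

text \<open>The bound K r^2 reproduces itself under the recursion as soon as K absorbs the
  transversal error, and the strict inequality for \<open>\<Lambda>\<close> leaves room for exactly
  that.\<close>

lemma energy_bound:
  fixes \<omega> :: "real \<Rightarrow> real"
  assumes \<omega>[measurable]: "\<omega> \<in> borel_measurable borel"
    and \<omega>_nonneg: "\<And>x. x \<in> {0..<1} \<Longrightarrow> \<omega> x \<ge> 0"
    and V: "\<And>x u v. x \<in> {0..<1} \<Longrightarrow> u \<in> words b q \<Longrightarrow> v \<in> words b q \<Longrightarrow> V x u v \<ge> 0"
    and E: "\<And>x u v. x \<in> {0..<1} \<Longrightarrow> (u, v) \<in> Eset b \<gamma> \<psi> q x \<epsilon> \<delta> \<Longrightarrow> V x u v * V x v u \<ge> (1::real)"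
    and \<epsilon>: "\<epsilon> > 0" and \<delta>: "\<delta> > 0" and q: "q \<ge> 1"
    and \<Lambda>: "\<Lambda> \<ge> 0" "AE x in lborel. x \<in> {0..<1} \<longrightarrow> (\<forall>k\<in>words b q. \<omega> x * (\<Sum>l\<in>words b q. V x k l) \<le> \<Lambda> * \<omega> (xw b x k))"
    and \<Lambda>_less: "\<Lambda> < (\<gamma> * real b) ^ q"
    and W: "W \<ge> 0" "AE x in lborel. x \<in> {0..<1} \<longrightarrow> \<omega> x \<le> W"
  obtains K r where "K \<ge> 0" "\<And>n. r n > 0" "r \<longlonglongrightarrow> 0" "\<And>n. weighted_energy \<omega> (r n) \<le> ennreal (K * (r n)\<^sup>2)"
proof -
  obtain C where C: "C \<ge> 0" "\<And>r. r > 0 \<Longrightarrow> 2 * r \<le> \<epsilon> \<Longrightarrow>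
    ennreal ((real (b ^ q))\<^sup>2) * weighted_energy \<omega> r \<le> ennreal (\<Lambda> * \<gamma> ^ q * real (b ^ q)) * weighted_energy \<omega> (r / \<gamma> ^ q) + ennreal (C * r\<^sup>2)"
    using energy_recursion[OF \<omega> \<omega>_nonneg V E \<delta> \<Lambda> W] by blast
  \<comment> \<open>Starting from \<epsilon>/2 keeps \<open>2 * r n \<le> \<epsilon>\<close> for all
    n, and the ratio is that of the recursion, so \<open>r (Suc n) / \<gamma> ^ q\<close> is again
    \<open>r n\<close>.\<close>
  define r where "r n = (\<gamma> ^ q) ^ n * (\<epsilon> / 2)" for n
  define B where "B = real (b ^ q)"
  define g where "g = \<gamma> ^ q"
  have g: "0 < g" "g < 1"
    using \<gamma>_pos \<gamma>(2) q by (auto simp: g_def power_less_one_iff)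
  have B: "B > 0" using b_pos by (simp add: B_def)
  have gap: "\<Lambda> < g * B" using \<Lambda>_less by (simp add: g_def B_def power_mult_distrib)
  have r_pos: "r n > 0" for n using g \<epsilon> by (simp add: r_def g_def[symmetric])
  have r_Suc: "r (Suc n) = g * r n" for n by (simp add: r_def g_def)
  have r_le: "2 * r n \<le> \<epsilon>" for n
    using g \<epsilon> by (simp add: r_def g_def[symmetric] mult_left_le_one_le power_le_one)
  have r_lim: "r \<longlonglongrightarrow> 0"
    unfolding r_def g_def[symmetric] using g by (intro tendsto_mult_left_zero LIMSEQ_realpow_zero) auto
  \<comment> \<open>Inserting K r^2 at both radii, where \<open>r n\<close> equals
    \<open>r (Suc n) / g\<close>, the induction step reduces to \<open>C \<le> K * a\<close>; and
    \<open>a\<close> is positive because \<open>\<Lambda> < g * B\<close>.\<close>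
  define a where "a = B\<^sup>2 - \<Lambda> * B / g"
  have "\<Lambda> * B < g * B * B" using gap B by simp
  then have a: "a > 0" using g by (simp add: a_def power2_eq_square field_simps)
  \<comment> \<open>The first entry serves the induction step. The second serves n = 0, where the
    trivial bound \<open>W * (2 * r 0)\<close> equals
    \<open>(W * 4 / \<epsilon>) * (r 0)\<^sup>2\<close> because \<open>r 0\<close> is
    \<epsilon>/2.\<close>
  define K where "K = max (C / a) (W * 4 / \<epsilon>)"
  have K: "K \<ge> 0" using C a by (simp add: K_def le_max_iff_disj)
  have bound: "weighted_energy \<omega> (r n) \<le> ennreal (K * (r n)\<^sup>2)" for n
  proof (induction n)
    case 0
    have "weighted_energy \<omega> (r 0) \<le> (\<integral>\<^sup>+x. ennreal (W * (2 * r 0)) * indicator {0..<1::real} x \<partial>lborel)"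
      unfolding weighted_energy_def
    proof (rule nn_integral_mono_AE)
      show "AE x in lborel. ennreal (\<omega> x) * energy (r 0) x * indicator {0..<1} x \<le> ennreal (W * (2 * r 0)) * indicator {0..<1} x"
        using W(2)
      proof eventually_elim
        case (elim x)
        show ?case
        proof (cases "x \<in> {0..<1}")
          case True
          have "ennreal (\<omega> x) * energy (r 0) x \<le> ennreal W * ennreal (2 * r 0)"
            using elim True r_pos[of 0] by (intro mult_mono energy_le) (auto intro: ennreal_leI)
          also have "\<dots> = ennreal (W * (2 * r 0))" using W(1) r_pos[of 0] by (simp add: ennreal_mult)
          finally show ?thesis by (intro mult_right_mono) auto
        qed simp
      qed
    qed
    also have "\<dots> = ennreal (W * (2 * r 0))"
      by (subst nn_integral_cmult_indicator) auto
    also have "\<dots> \<le> ennreal (K * (r 0)\<^sup>2)"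
    proof (rule ennreal_leI)
      have "W * (2 * r 0) = (W * 4 / \<epsilon>) * (r 0)\<^sup>2" using \<epsilon> by (simp add: r_def power2_eq_square)
      also have "\<dots> \<le> K * (r 0)\<^sup>2" by (intro mult_right_mono) (auto simp: K_def)
      finally show "W * (2 * r 0) \<le> K * (r 0)\<^sup>2" .
    qed
    finally show ?case .
  next
    case (Suc n)
    have "ennreal (B\<^sup>2) * weighted_energy \<omega> (r (Suc n)) \<le> ennreal (\<Lambda> * g * B) * weighted_energy \<omega> (r n) + ennreal (C * (r (Suc n))\<^sup>2)"
      using C(2)[OF r_pos[of "Suc n"] r_le] g
      unfolding B_def[symmetric] g_def[symmetric] by (simp add: r_Suc)
    also have "\<dots> \<le> ennreal (\<Lambda> * g * B) * ennreal (K * (r n)\<^sup>2) + ennreal (C * (r (Suc n))\<^sup>2)"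
      by (intro add_mono mult_left_mono Suc) auto
    also have "\<dots> = ennreal (\<Lambda> * g * B * (K * (r n)\<^sup>2) + C * (r (Suc n))\<^sup>2)"
      using \<Lambda> g B K C by (simp add: ennreal_mult ennreal_plus)
    also have "\<dots> \<le> ennreal (B\<^sup>2 * (K * (r (Suc n))\<^sup>2))"
    proof (rule ennreal_leI)
      have "C \<le> K * a" using a by (simp add: K_def pos_divide_le_eq[symmetric])
      then have "C * (r (Suc n))\<^sup>2 \<le> K * a * (r (Suc n))\<^sup>2" by (rule mult_right_mono) simp
      also have "\<dots> = B\<^sup>2 * (K * (r (Suc n))\<^sup>2) - \<Lambda> * g * B * (K * (r n)\<^sup>2)"
        using g by (simp add: a_def r_Suc power2_eq_square field_simps)
      finally show "\<Lambda> * g * B * (K * (r n)\<^sup>2) + C * (r (Suc n))\<^sup>2 \<le> B\<^sup>2 * (K * (r (Suc n))\<^sup>2)" by simp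
    qed
    also have "\<dots> = ennreal (B\<^sup>2) * ennreal (K * (r (Suc n))\<^sup>2)"
      using K by (simp add: ennreal_mult)
    finally show ?case
      using B by (subst (asm) ennreal_mult_le_mult_iff) auto
  qed
  show ?thesis by (rule that[OF K r_pos r_lim bound])
qed

end

section \<open>From bounded energy to densities\<close>

text \<open>Rational endpoints make the generator countable, so identities known almost everywhere
  for each single half-line can be imposed for all of them at once.\<close>

lemma measure_eqI_greaterThan_rat:
  fixes M N :: "real measure"
  assumes sets: "sets M = sets borel" "sets N = sets borel"
    and fin: "finite_measure M"
    and eq: "\<And>p :: rat. emeasure M {of_rat p<..} = emeasure N {of_rat p<..}"
  shows "M = N"
proof (rule measure_eqI_generator_eq_countable)
  let ?E = "range (\<lambda>p :: rat. {of_rat p :: real<..})"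
  have "sigma_sets UNIV (range (greaterThan :: real \<Rightarrow> _)) = sigma_sets UNIV ?E"
  proof (rule sigma_sets_eqI)
    fix A :: "real set" assume "A \<in> range greaterThan"
    then obtain t where A: "A = {t<..}" by auto
    have "A = (\<Union>p\<in>{p :: rat. t < of_rat p}. {of_rat p<..})"
      unfolding A by (auto dest: of_rat_dense less_trans)
    also have "\<dots> \<in> sigma_sets UNIV ?E"
      by (intro sigma_sets_UNION) auto
    finally show "A \<in> sigma_sets UNIV ?E" .
  qed auto
  then have E: "sets borel = sigma_sets UNIV ?E"
    by (subst borel_Ioi) simp
  show "sets M = sigma_sets UNIV ?E" "sets N = sigma_sets UNIV ?E"
    using sets E by auto
  show "Int_stable ?E"
  proof (rule Int_stableI)
    fix A B assume "A \<in> ?E" "B \<in> ?E"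
    then obtain p p' where "A = {of_rat p<..}" "B = {of_rat p'<..}" by auto
    moreover have "{x<..} \<inter> {y<..} = {max x y<..}" for x y :: real by auto
    moreover have "max (of_rat p :: real) (of_rat p') = of_rat (max p p')"
      by (simp add: max_def of_rat_less_eq)
    ultimately have "A \<inter> B = {of_rat (max p p')<..}" by simp
    then show "A \<inter> B \<in> ?E" by auto
  qed
  have "x \<in> \<Union>?E" for x :: real
    using of_rat_dense[of "x - 1" x] by auto
  then show "\<Union>?E = UNIV" by blast
  show "countable ?E" by auto
  show "emeasure M A \<noteq> \<infinity>" for A
    using finite_measure.emeasure_finite[OF fin] by simp
qed (use eq in auto)

context skew_product
begin

text \<open>\<open>vartheta\<close> is a bare set function; this is a measure on the plane with the
  same values on Borel sets. Lebesgue measure on [0,1) is written as a density so that the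
  underlying space stays the whole line.\<close>

definition \<Theta> :: "(real \<times> real) measure" where
  "\<Theta> = distr (density lborel (indicator {0..<1}) \<Otimes>\<^sub>M P) borel (\<lambda>(x, i). (x, SS x i))"

lemma sets_\<Theta>[simp, measurable_cong]: "sets \<Theta> = sets borel"
  by (simp add: \<Theta>_def)

lemma nn_integral_base:
  assumes [measurable]: "f \<in> borel_measurable (borel \<Otimes>\<^sub>M P)"
  shows "(\<integral>\<^sup>+z. f z \<partial>(density lborel (indicator {0..<1}) \<Otimes>\<^sub>M P))
    = (\<integral>\<^sup>+x. (\<integral>\<^sup>+i. f (x, i) \<partial>P) * indicator {0..<1::real} x \<partial>lborel)"
proof -
  have "(\<integral>\<^sup>+z. f z \<partial>(density lborel (indicator {0..<1}) \<Otimes>\<^sub>M P))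
      = (\<integral>\<^sup>+x. \<integral>\<^sup>+i. f (x, i) \<partial>P \<partial>density lborel (indicator {0..<1}))"
    by (rule P.nn_integral_fst[symmetric]) measurable
  also have "\<dots> = (\<integral>\<^sup>+x. indicator {0..<1} x * (\<integral>\<^sup>+i. f (x, i) \<partial>P) \<partial>lborel)"
    by (rule nn_integral_density) measurable
  finally show ?thesis by (simp add: mult.commute)
qed

lemma measurable_graph[measurable]: "(\<lambda>(x, i). (x, SS x i)) \<in> measurable (borel \<Otimes>\<^sub>M P) (borel :: (real \<times> real) measure)"
  unfolding borel_prod[symmetric] by measurable

lemma nn_integral_\<Theta>:
  assumes f[measurable]: "f \<in> borel_measurable borel"
  shows "(\<integral>\<^sup>+z. f z \<partial>\<Theta>) = (\<integral>\<^sup>+x. (\<integral>\<^sup>+i. f (x, SS x i) \<partial>P) * indicator {0..<1} x \<partial>lborel)"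
proof -
  have 1: "(\<lambda>z. f (case z of (x, i) \<Rightarrow> (x, SS x i))) \<in> borel_measurable (borel \<Otimes>\<^sub>M P)"
    by measurable
  have "(\<integral>\<^sup>+z. f z \<partial>\<Theta>) = (\<integral>\<^sup>+z. f (case z of (x, i) \<Rightarrow> (x, SS x i)) \<partial>(density lborel (indicator {0..<1}) \<Otimes>\<^sub>M P))"
    unfolding \<Theta>_def by (rule nn_integral_distr) measurable
  then show ?thesis unfolding nn_integral_base[OF 1] by simp
qed

lemma finite_\<Theta>: "finite_measure \<Theta>"
proof (rule finite_measureI)
  have "emeasure \<Theta> (space \<Theta>) = (\<integral>\<^sup>+z. 1 \<partial>\<Theta>)" by simp
  also have "\<dots> = (\<integral>\<^sup>+x. indicator {0..<1::real} x \<partial>lborel)"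
    by (subst nn_integral_\<Theta>) (use P.emeasure_space_1 in auto)
  finally show "emeasure \<Theta> (space \<Theta>) \<noteq> \<infinity>" by simp
qed

lemma emeasure_mx:
  assumes [measurable]: "A \<in> sets borel"
  shows "emeasure (mx b \<gamma> \<psi> x) A = (\<integral>\<^sup>+i. indicator A (SS x i) \<partial>P)"
proof -
  have "(\<integral>\<^sup>+y. indicator A y \<partial>mx b \<gamma> \<psi> x) = (\<integral>\<^sup>+i. indicator A (SS x i) \<partial>P)"
    unfolding mx_def by (rule nn_integral_distr) measurable
  then show ?thesis by (simp add: mx_def)
qed

lemma vartheta_eq_\<Theta>:
  assumes B[measurable]: "B \<in> sets borel"
  shows "vartheta b \<gamma> \<psi> B = emeasure \<Theta> B"
proof -
  have slice: "{y. (x, y) \<in> B} \<in> sets borel" for x :: real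
  proof -
    have "(\<lambda>y. (x, y)) -` B \<inter> space borel \<in> sets borel"
      by (rule measurable_sets[OF _ B]) (simp add: borel_prod[symmetric])
    then show ?thesis by (simp add: vimage_def)
  qed
  have "emeasure \<Theta> B = (\<integral>\<^sup>+z. indicator B z \<partial>\<Theta>)" by simp
  also have "\<dots> = (\<integral>\<^sup>+x. (\<integral>\<^sup>+i. indicator B (x, SS x i) \<partial>P) * indicator {0..<1} x \<partial>lborel)"
    by (rule nn_integral_\<Theta>) measurable
  also have "\<dots> = vartheta b \<gamma> \<psi> B"
    unfolding vartheta_def emeasure_mx[OF slice] by (simp add: indicator_def)
  finally show ?thesis by simp
qed

text \<open>Fatou's lemma compares a lower semicontinuous function with its vertical averages at
  scale \<open>r n\<close>, whose integral against \<open>\<Theta>\<close> is an integral of the smoothed density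
  \<open>ball_mass (r n) / (2 r n)\<close> against Lebesgue measure.\<close>

lemma \<Theta>_open_ineq:
  assumes r: "\<And>n. r n > 0" "r \<longlonglongrightarrow> 0" and K: "K \<ge> 0"
    and energy: "\<And>n. (\<integral>\<^sup>+x. energy (r n) x * indicator {0..<1} x \<partial>lborel) \<le> ennreal (K * (r n)\<^sup>2)"
    and I: "finite I" and U: "\<And>c. c \<in> I \<Longrightarrow> open (U c)"
  shows "2 * (\<integral>\<^sup>+z. (\<Sum>c\<in>I. c * indicator (U c) z) \<partial>\<Theta>)
    \<le> (\<integral>\<^sup>+z. (\<Sum>c\<in>I. c * indicator (U c) z)\<^sup>2 \<partial>lborel) + ennreal (K / 4)"
proof -
  let ?M = "density lborel (indicator {0..<1}) \<Otimes>\<^sub>M P"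
  define f :: "real \<times> real \<Rightarrow> ennreal" where "f z = (\<Sum>c\<in>I. c * indicator (U c) z)" for z
  have [measurable]: "f \<in> borel_measurable borel"
    unfolding f_def[abs_def] using U by (intro borel_measurable_sum) auto
  have [measurable]: "(\<lambda>p. f (g p, h p)) \<in> borel_measurable N"
    if [measurable]: "g \<in> borel_measurable N" "h \<in> borel_measurable N" for g h and N :: "'z measure"
    by measurable
  \<comment> \<open>Division by \<open>r n\<close> instead of the interval length
    \<open>2 * r n\<close> makes these averages approximate \<open>2 * f\<close>, the left-hand side
    of the claim.\<close>
  define av where "av n z = ennreal (1 / r n) * (\<integral>\<^sup>+t. f (fst z, t) * indicator {- r n..r n} (SS (fst z) (snd z) - t) \<partial>lborel)" for n z
  have [measurable]: "av n \<in> borel_measurable (borel \<Otimes>\<^sub>M P)" for n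
    unfolding av_def[abs_def] by measurable
  have av_measurable: "av n \<in> borel_measurable ?M" for n by measurable
  have av_ge: "2 * f (x, SS x i) \<le> liminf (\<lambda>n. av n (x, i))" for x i
  proof (rule Liminf_bounded)
    let ?s = "SS x i"
    have "\<forall>\<^sub>F n in sequentially. \<forall>t. \<bar>?s - t\<bar> \<le> r n \<longrightarrow> (indicator (U c) (x, ?s) :: ennreal) \<le> indicator (U c) (x, t)"
      if c: "c \<in> I" for c
    proof (cases "(x, ?s) \<in> U c")
      case True
      then obtain e where e: "e > 0" "ball (x, ?s) e \<subseteq> U c"
        using U[OF c] openE by blast
      have "\<forall>\<^sub>F n in sequentially. r n < e" using r(2) e(1) by (rule order_tendstoD)
      then show ?thesis
      proof eventually_elim
        case (elim n)
        show ?case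
        proof (intro allI impI)
          fix t assume "\<bar>?s - t\<bar> \<le> r n"
          then have "(x, t) \<in> ball (x, ?s) e" using elim by (simp add: dist_Pair_Pair dist_real_def)
          then show "(indicator (U c) (x, ?s) :: ennreal) \<le> indicator (U c) (x, t)"
            using e(2) by (auto simp: indicator_def)
        qed
      qed
    qed simp
    then have "\<forall>\<^sub>F n in sequentially. \<forall>c\<in>I. \<forall>t. \<bar>?s - t\<bar> \<le> r n \<longrightarrow> (indicator (U c) (x, ?s) :: ennreal) \<le> indicator (U c) (x, t)"
      using I by (simp add: eventually_ball_finite_distrib)
    then show "\<forall>\<^sub>F n in sequentially. 2 * f (x, ?s) \<le> av n (x, i)"
    proof eventually_elim
      case (elim n)
      have "ennreal (1 / r n) * ennreal (2 * r n) = 2"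
        using r(1)[of n] by (subst ennreal_mult[symmetric]) auto
      then have "2 * f (x, ?s) = ennreal (1 / r n) * (f (x, ?s) * ennreal (2 * r n))"
        by (metis mult.assoc mult.commute)
      also have "ennreal (2 * r n) = (\<integral>\<^sup>+t. indicator {- r n..r n} (?s - t) \<partial>lborel)"
      proof -
        have "(\<integral>\<^sup>+t. indicator {- r n..r n} (?s - t) \<partial>lborel) = (\<integral>\<^sup>+t. indicator {?s - r n..?s + r n} t \<partial>lborel)"
          by (intro nn_integral_cong) (auto simp: indicator_def)
        then show ?thesis using r(1)[of n] by simp
      qed
      also have "f (x, ?s) * (\<integral>\<^sup>+t. indicator {- r n..r n} (?s - t) \<partial>lborel)
          = (\<integral>\<^sup>+t. f (x, ?s) * indicator {- r n..r n} (?s - t) \<partial>lborel)"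
        by (rule nn_integral_cmult[symmetric]) measurable
      also have "ennreal (1 / r n) * \<dots> \<le> av n (x, i)"
        unfolding av_def fst_conv snd_conv
      proof (intro mult_left_mono nn_integral_mono)
        fix t
        show "f (x, ?s) * indicator {- r n..r n} (?s - t) \<le> f (x, t) * indicator {- r n..r n} (?s - t)"
        proof (cases "\<bar>?s - t\<bar> \<le> r n")
          case True
          have "f (x, ?s) \<le> f (x, t)"
            unfolding f_def using elim True by (intro sum_mono mult_left_mono) auto
          then show ?thesis by (rule mult_right_mono) simp
        next
          case False
          then show ?thesis by (auto simp: indicator_def abs_le_iff)
        qed
      qed simp
      finally show ?case .
    qed
  qed
  have av_le: "(\<integral>\<^sup>+z. av n z \<partial>?M) \<le> (\<integral>\<^sup>+z. (f z)\<^sup>2 \<partial>lborel) + ennreal (K / 4)" for n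
  proof -
    let ?R = "ennreal (1 / r n)"
    \<comment> \<open>Young's inequality for a and y/2, with y the ball mass divided by
      \<open>r n\<close>. The factor 1/4 from the halving, against an energy of at most K r^2, is
      the origin of the constant \<open>K / 4\<close>.\<close>
    have sq: "f z * (?R * ennreal (ball_mass (r n) x t)) \<le> (f z)\<^sup>2 + ennreal (1 / (4 * (r n)\<^sup>2)) * ennreal ((ball_mass (r n) x t)\<^sup>2)" for x t z
    proof (cases "f z")
      case (real a)
      let ?y = "ball_mass (r n) x t / r n"
      have "0 \<le> (a - ?y / 2)\<^sup>2" by simp
      then have "a * ?y \<le> a\<^sup>2 + 1 / (4 * (r n)\<^sup>2) * (ball_mass (r n) x t)\<^sup>2"
        by (simp add: power2_diff power_divide)
      then have "ennreal (a * ?y) \<le> ennreal (a\<^sup>2 + 1 / (4 * (r n)\<^sup>2) * (ball_mass (r n) x t)\<^sup>2)"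
        by (rule ennreal_leI)
      moreover have "f z * (?R * ennreal (ball_mass (r n) x t)) = ennreal (a * ?y)"
        using real r(1)[of n] ball_mass_nonneg[of "r n" x t] by (simp add: ennreal_mult[symmetric])
      moreover have "(f z)\<^sup>2 + ennreal (1 / (4 * (r n)\<^sup>2)) * ennreal ((ball_mass (r n) x t)\<^sup>2)
          = ennreal (a\<^sup>2 + 1 / (4 * (r n)\<^sup>2) * (ball_mass (r n) x t)\<^sup>2)"
        using real r(1)[of n] by (simp add: ennreal_power ennreal_plus ennreal_mult[symmetric])
      ultimately show ?thesis by simp
    qed (simp add: top_power_ennreal)
    have inner: "(\<integral>\<^sup>+i. av n (x, i) \<partial>P) = (\<integral>\<^sup>+t. f (x, t) * (?R * ennreal (ball_mass (r n) x t)) \<partial>lborel)" for x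
    proof -
      interpret pair_sigma_finite lborel P ..
      have "(\<integral>\<^sup>+i. av n (x, i) \<partial>P) = (\<integral>\<^sup>+i. \<integral>\<^sup>+t. ?R * (f (x, t) * indicator {- r n..r n} (SS x i - t)) \<partial>lborel \<partial>P)"
        unfolding av_def fst_conv snd_conv by (intro nn_integral_cong nn_integral_cmult[symmetric]) measurable
      also have "\<dots> = (\<integral>\<^sup>+t. \<integral>\<^sup>+i. ?R * (f (x, t) * indicator {- r n..r n} (SS x i - t)) \<partial>P \<partial>lborel)"
        by (rule Fubini') measurable
      also have "\<dots> = (\<integral>\<^sup>+t. f (x, t) * (?R * ennreal (ball_mass (r n) x t)) \<partial>lborel)"
      proof (intro nn_integral_cong)
        fix t
        have "(\<integral>\<^sup>+i. ?R * (f (x, t) * indicator {- r n..r n} (SS x i - t)) \<partial>P)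
            = (\<integral>\<^sup>+i. (f (x, t) * ?R) * indicator {- r n..r n} (SS x i - t) \<partial>P)"
          by (simp only: ac_simps)
        also have "\<dots> = (f (x, t) * ?R) * (\<integral>\<^sup>+i. indicator {- r n..r n} (SS x i - t) \<partial>P)"
          by (rule nn_integral_cmult) measurable
        finally show "(\<integral>\<^sup>+i. ?R * (f (x, t) * indicator {- r n..r n} (SS x i - t)) \<partial>P)
            = f (x, t) * (?R * ennreal (ball_mass (r n) x t))"
          by (simp only: ball_mass_eq_nn_integral mult.assoc)
      qed
      finally show ?thesis .
    qed
    have "(\<integral>\<^sup>+z. av n z \<partial>?M) = (\<integral>\<^sup>+x. (\<integral>\<^sup>+i. av n (x, i) \<partial>P) * indicator {0..<1} x \<partial>lborel)"
      by (rule nn_integral_base) measurable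
    also have "\<dots> \<le> (\<integral>\<^sup>+x. (\<integral>\<^sup>+t. (f (x, t))\<^sup>2 + ennreal (1 / (4 * (r n)\<^sup>2)) * ennreal ((ball_mass (r n) x t)\<^sup>2) \<partial>lborel) * indicator {0..<1} x \<partial>lborel)"
      unfolding inner by (intro nn_integral_mono mult_right_mono sq) auto
    also have "\<dots> = (\<integral>\<^sup>+x. ((\<integral>\<^sup>+t. (f (x, t))\<^sup>2 \<partial>lborel) + ennreal (1 / (4 * (r n)\<^sup>2)) * energy (r n) x) * indicator {0..<1} x \<partial>lborel)"
      unfolding energy_def by (subst nn_integral_add) (auto simp: nn_integral_cmult)
    also have "\<dots> \<le> (\<integral>\<^sup>+x. (\<integral>\<^sup>+t. (f (x, t))\<^sup>2 \<partial>lborel) + ennreal (1 / (4 * (r n)\<^sup>2)) * (energy (r n) x * indicator {0..<1} x) \<partial>lborel)"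
      by (intro nn_integral_mono) (auto simp: indicator_def)
    also have "\<dots> = (\<integral>\<^sup>+x. \<integral>\<^sup>+t. (f (x, t))\<^sup>2 \<partial>lborel \<partial>lborel)
        + ennreal (1 / (4 * (r n)\<^sup>2)) * (\<integral>\<^sup>+x. energy (r n) x * indicator {0..<1} x \<partial>lborel)"
      by (subst nn_integral_add) (auto simp: nn_integral_cmult)
    also have "(\<integral>\<^sup>+x. \<integral>\<^sup>+t. (f (x, t))\<^sup>2 \<partial>lborel \<partial>lborel) = (\<integral>\<^sup>+z. (f z)\<^sup>2 \<partial>(lborel \<Otimes>\<^sub>M lborel))"
      by (rule lborel.nn_integral_fst) (simp add: lborel_prod)
    also have "ennreal (1 / (4 * (r n)\<^sup>2)) * (\<integral>\<^sup>+x. energy (r n) x * indicator {0..<1} x \<partial>lborel)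
        \<le> ennreal (1 / (4 * (r n)\<^sup>2)) * ennreal (K * (r n)\<^sup>2)"
      by (intro mult_left_mono energy) auto
    also have "\<dots> = ennreal (K / 4)"
      using r(1)[of n] K by (subst ennreal_mult[symmetric]) auto
    finally show ?thesis by (simp add: lborel_prod)
  qed
  have "2 * (\<integral>\<^sup>+z. f z \<partial>\<Theta>) = (\<integral>\<^sup>+z. 2 * f z \<partial>\<Theta>)"
    by (simp add: nn_integral_cmult)
  also have "\<dots> = (\<integral>\<^sup>+z. 2 * f (case z of (x, i) \<Rightarrow> (x, SS x i)) \<partial>?M)"
    unfolding \<Theta>_def by (rule nn_integral_distr) measurable
  also have "\<dots> \<le> (\<integral>\<^sup>+z. liminf (\<lambda>n. av n z) \<partial>?M)"
    by (intro nn_integral_mono) (auto intro: av_ge)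
  also have "\<dots> \<le> liminf (\<lambda>n. \<integral>\<^sup>+z. av n z \<partial>?M)"
    by (rule nn_integral_liminf[OF av_measurable])
  also have "\<dots> \<le> (\<integral>\<^sup>+z. (f z)\<^sup>2 \<partial>lborel) + ennreal (K / 4)"
    by (rule order_trans[OF Liminf_le_Limsup Limsup_bounded]) (simp_all add: av_le)
  finally show ?thesis unfolding f_def .
qed

text \<open>Testing \<Theta> on rectangles X \<times> A shows that, for each fixed A, both
  candidates for the mass of A on the fibre over x have the same integral over every X, hence agree
  for a.e. x. The exceptional set depends on A, so the comparison is made on rational half-lines,
  which determine a finite measure.\<close>

lemma fibre_densities:
  fixes f :: "real \<times> real \<Rightarrow> real"
  assumes f[measurable]: "f \<in> borel_measurable borel"
    and \<Theta>_f: "\<Theta> = density lborel (\<lambda>z. ennreal (f z))"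
  shows "AE x in lborel. x \<in> {0..<1} \<longrightarrow> mx b \<gamma> \<psi> x = density lborel (\<lambda>y. ennreal (f (x, y)))"
proof -
  have [measurable]: "f \<in> borel_measurable (borel \<Otimes>\<^sub>M borel)"
    using f by (simp add: borel_prod)
  have "AE x in lborel. emeasure (mx b \<gamma> \<psi> x) A * indicator {0..<1} x
      = (\<integral>\<^sup>+y. ennreal (f (x, y)) * indicator A y \<partial>lborel) * indicator {0..<1} x"
    if A[measurable]: "A \<in> sets borel" for A
  proof (rule sigma_finite_measure.density_unique[OF sigma_finite_lborel])
    have [measurable]: "(\<lambda>x. emeasure (mx b \<gamma> \<psi> x) A) \<in> borel_measurable borel"
      unfolding emeasure_mx[OF A] by measurable
    show "(\<lambda>x. emeasure (mx b \<gamma> \<psi> x) A * indicator {0..<1} x) \<in> borel_measurable lborel"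
      "(\<lambda>x. (\<integral>\<^sup>+y. ennreal (f (x, y)) * indicator A y \<partial>lborel) * indicator {0..<1} x) \<in> borel_measurable lborel"
      by measurable
    show "density lborel (\<lambda>x. emeasure (mx b \<gamma> \<psi> x) A * indicator {0..<1} x)
        = density lborel (\<lambda>x. (\<integral>\<^sup>+y. ennreal (f (x, y)) * indicator A y \<partial>lborel) * indicator {0..<1} x)"
    proof (rule measure_eqI)
      fix X assume "X \<in> sets (density lborel (\<lambda>x. emeasure (mx b \<gamma> \<psi> x) A * indicator {0..<1} x))"
      then have X[measurable]: "X \<in> sets borel" by simp
      let ?Y = "X \<inter> {0..<1}"
      have Y[measurable]: "?Y \<times> A \<in> sets borel"
        unfolding borel_prod[symmetric] by measurable
      have "emeasure (density lborel (\<lambda>x. emeasure (mx b \<gamma> \<psi> x) A * indicator {0..<1} x)) X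
          = (\<integral>\<^sup>+x. (\<integral>\<^sup>+i. indicator (?Y \<times> A) (x, SS x i) \<partial>P) * indicator {0..<1} x \<partial>lborel)"
        by (subst emeasure_density) (auto simp: emeasure_mx indicator_def intro!: nn_integral_cong)
      also have "\<dots> = emeasure \<Theta> (?Y \<times> A)"
        by (subst nn_integral_\<Theta>[symmetric]) auto
      also have "\<dots> = (\<integral>\<^sup>+z. ennreal (f z) * indicator (?Y \<times> A) z \<partial>(lborel \<Otimes>\<^sub>M lborel))"
        unfolding \<Theta>_f lborel_prod by (rule emeasure_density) auto
      also have "\<dots> = (\<integral>\<^sup>+x. \<integral>\<^sup>+y. ennreal (f (x, y)) * indicator (?Y \<times> A) (x, y) \<partial>lborel \<partial>lborel)"
        by (rule lborel.nn_integral_fst[symmetric]) measurable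
      also have "\<dots> = emeasure (density lborel (\<lambda>x. (\<integral>\<^sup>+y. ennreal (f (x, y)) * indicator A y \<partial>lborel) * indicator {0..<1} x)) X"
        by (subst emeasure_density) (auto simp: indicator_def intro!: nn_integral_cong)
      finally show "emeasure (density lborel (\<lambda>x. emeasure (mx b \<gamma> \<psi> x) A * indicator {0..<1} x)) X
        = emeasure (density lborel (\<lambda>x. (\<integral>\<^sup>+y. ennreal (f (x, y)) * indicator A y \<partial>lborel) * indicator {0..<1} x)) X" .
    qed simp
  qed
  then have "AE x in lborel. \<forall>p :: rat. emeasure (mx b \<gamma> \<psi> x) {of_rat p<..} * indicator {0..<1} x
      = (\<integral>\<^sup>+y. ennreal (f (x, y)) * indicator {of_rat p<..} y \<partial>lborel) * indicator {0..<1} x"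
    by (subst AE_all_countable) auto
  then show ?thesis
  proof eventually_elim
    case (elim x)
    show ?case
    proof
      assume x: "x \<in> {0..<1}"
      show "mx b \<gamma> \<psi> x = density lborel (\<lambda>y. ennreal (f (x, y)))"
      proof (rule measure_eqI_greaterThan_rat)
        show "finite_measure (mx b \<gamma> \<psi> x)"
          unfolding mx_def by (intro P.finite_measure_distr) measurable
        show "emeasure (mx b \<gamma> \<psi> x) {of_rat p<..} = emeasure (density lborel (\<lambda>y. ennreal (f (x, y)))) {of_rat p<..}" for p :: rat
          using elim x by (subst emeasure_density) auto
      qed (auto simp: mx_def)
    qed
  qed
qed

end

section \<open>Extracting the hypotheses of the recursion from \<sigma>(q)\<close>

lemma weight_function_bounded:
  assumes "Linf_norm f < \<infinity>"
  obtains W :: real where "W > 0" "AE x in lborel. x \<in> {0..<1} \<longrightarrow> \<bar>f x\<bar> \<le> W"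
proof -
  obtain W :: real where W: "Linf_norm f < ereal W" "W > 0"
  proof -
    from assms obtain w :: ereal where w: "Linf_norm f < w" "w < \<infinity>"
      using dense by blast
    then obtain w' where w': "w = ereal w'" by (cases w) auto
    have "Linf_norm f < ereal (max w' 1)"
      using w w' by (metis ereal_less_eq(3) less_le_trans max.cobounded1)
    then show ?thesis using that[of "max w' 1"] by simp
  qed
  have "AE x in leb01. ereal \<bar>f x\<bar> \<le> Linf_norm f"
    unfolding Linf_norm_def by (rule esssup_AE)
  then have "AE x in leb01. \<bar>f x\<bar> \<le> W"
  proof eventually_elim
    case (elim x)
    then have "ereal \<bar>f x\<bar> \<le> ereal W" using W(1) by (meson le_less_trans less_imp_le)
    then show ?case by simp
  qed
  then have "AE x in lborel. x \<in> {0..<1} \<longrightarrow> \<bar>f x\<bar> \<le> W"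
    unfolding leb01_def by (simp add: AE_restrict_space_iff)
  with W(2) that show ?thesis by blast
qed

text \<open>Each word is bounded by the maximum defining \<open>Sigma_fun\<close>, and the
  denominator is cleared by positivity of \<omega> at x(k), which again lies in [0,1). The product
  form is what the recursion consumes.\<close>

lemma Sigma_fun_AE_le:
  assumes "Linf_norm (Sigma_fun b q V \<omega>) < ereal c" "c > 0"
    and b: "b > 0" and \<omega>: "\<And>x. x \<in> {0..<1} \<Longrightarrow> \<omega> x > 0"
  obtains \<Lambda> :: real where "0 \<le> \<Lambda>" "\<Lambda> < c"
    "AE x in lborel. x \<in> {0..<1} \<longrightarrow> (\<forall>k\<in>words b q. \<omega> x * (\<Sum>l\<in>words b q. V x k l) \<le> \<Lambda> * \<omega> (xw b x k))"
proof -
  obtain \<Lambda> :: real where \<Lambda>: "Linf_norm (Sigma_fun b q V \<omega>) \<le> ereal \<Lambda>" "0 \<le> \<Lambda>" "\<Lambda> < c"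
  proof (cases "Linf_norm (Sigma_fun b q V \<omega>)")
    case (real s)
    then show ?thesis using assms(1,2) that[of "max s 0"] by auto
  qed (use assms(1,2) that[of 0] in auto)
  have "AE x in leb01. ereal \<bar>Sigma_fun b q V \<omega> x\<bar> \<le> Linf_norm (Sigma_fun b q V \<omega>)"
    unfolding Linf_norm_def by (rule esssup_AE)
  then have "AE x in leb01. \<bar>Sigma_fun b q V \<omega> x\<bar> \<le> \<Lambda>"
    by eventually_elim (use \<Lambda>(1) in \<open>metis ereal_less_eq(3) order_trans\<close>)
  then have "AE x in lborel. x \<in> {0..<1} \<longrightarrow> \<bar>Sigma_fun b q V \<omega> x\<bar> \<le> \<Lambda>"
    unfolding leb01_def by (simp add: AE_restrict_space_iff)
  then have "AE x in lborel. x \<in> {0..<1} \<longrightarrow> (\<forall>k\<in>words b q. \<omega> x * (\<Sum>l\<in>words b q. V x k l) \<le> \<Lambda> * \<omega> (xw b x k))"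
  proof eventually_elim
    case (elim x)
    show ?case
    proof (intro impI ballI)
      fix k assume x: "x \<in> {0..<1}" and k: "k \<in> words b q"
      have "\<omega> x / \<omega> (xw b x k) * (\<Sum>l\<in>words b q. V x k l) \<le> Sigma_fun b q V \<omega> x"
        unfolding Sigma_fun_def using k by (intro Max_ge) auto
      also have "\<dots> \<le> \<Lambda>" using elim x by auto
      finally show "\<omega> x * (\<Sum>l\<in>words b q. V x k l) \<le> \<Lambda> * \<omega> (xw b x k)"
        using \<omega>[OF xw_in_unit[OF b x k]] by (simp add: field_simps)
    qed
  qed
  with \<Lambda>(2,3) that show ?thesis by blast
qed

text \<open>An infimum strictly below the threshold is undercut by some pair V, \<omega>. The upper
  bound of \<omega> feeds the iteration; the bound on 1/\<omega> removes the weight from its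
  result.\<close>

lemma (in skew_product) energy_of_sigma:
  assumes q: "q \<ge> 1" "sigma b \<gamma> \<psi> q < ereal ((\<gamma> * real b) ^ q)"
  obtains K r where "K \<ge> 0" "\<And>n. r n > 0" "r \<longlonglongrightarrow> 0"
    "\<And>n. (\<integral>\<^sup>+x. energy (r n) x * indicator {0..<1} x \<partial>lborel) \<le> ennreal (K * (r n)\<^sup>2)"
proof -
  from q(2) obtain V \<omega> where wf: "weight_function \<omega>" and adm: "admissible b \<gamma> \<psi> q V"
      and less: "Linf_norm (Sigma_fun b q V \<omega>) < ereal ((\<gamma> * real b) ^ q)"
    unfolding sigma_def by (auto simp: INF_less_iff)
  have \<omega>_pos: "\<And>x. x \<in> {0..<1} \<Longrightarrow> \<omega> x > 0"
    using wf by (auto simp: weight_function_def)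
  have V: "\<And>x u v. x \<in> {0..<1} \<Longrightarrow> u \<in> words b q \<Longrightarrow> v \<in> words b q \<Longrightarrow> V x u v \<ge> 0"
    using adm by (auto simp: admissible_def testing_function_def)
  obtain \<epsilon> \<delta> where \<epsilon>\<delta>: "\<epsilon> > 0" "\<delta> > 0"
      and E: "\<And>x u v. x \<in> {0..<1} \<Longrightarrow> (u, v) \<in> Eset b \<gamma> \<psi> q x \<epsilon> \<delta> \<Longrightarrow> V x u v * V x v u \<ge> 1"
    using adm unfolding admissible_def by fast
  obtain \<Lambda> where \<Lambda>: "0 \<le> \<Lambda>" "\<Lambda> < (\<gamma> * real b) ^ q"
    "AE x in lborel. x \<in> {0..<1} \<longrightarrow> (\<forall>k\<in>words b q. \<omega> x * (\<Sum>l\<in>words b q. V x k l) \<le> \<Lambda> * \<omega> (xw b x k))"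
    by (rule Sigma_fun_AE_le[OF less _ b_pos \<omega>_pos]) (use \<gamma>_pos b_pos in auto)
  obtain W where W: "W > 0" "AE x in lborel. x \<in> {0..<1} \<longrightarrow> \<bar>\<omega> x\<bar> \<le> W"
    using weight_function_bounded wf unfolding weight_function_def by metis
  obtain W' where W': "W' > 0" "AE x in lborel. x \<in> {0..<1} \<longrightarrow> \<bar>1 / \<omega> x\<bar> \<le> W'"
    using weight_function_bounded wf unfolding weight_function_def by metis
  \<comment> \<open>\<omega> is measurable only on [0,1); extension by 0 gives a Borel function on
    the line without changing any value that occurs in the integrals.\<close>
  define w where "w x = (if x \<in> {0..<1} then \<omega> x else 0)" for x
  have w_eq: "w x = \<omega> x" if "x \<in> {0..<1}" for x using that by (simp add: w_def)
  have w_meas[measurable]: "w \<in> borel_measurable borel"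
  proof -
    have "\<omega> \<in> borel_measurable (restrict_space lborel {0..<1})"
      using wf by (simp add: weight_function_def leb01_def)
    then have "(\<lambda>x. indicator {0..<1} x *\<^sub>R \<omega> x) \<in> borel_measurable lborel"
      by (subst (asm) borel_measurable_restrict_space_iff) auto
    also have "(\<lambda>x. indicator {0..<1} x *\<^sub>R \<omega> x) = w" by (auto simp: w_def indicator_def)
    finally show ?thesis by simp
  qed
  have w_nonneg: "w x \<ge> 0" if "x \<in> {0..<1}" for x
    using \<omega>_pos[OF that] by (simp add: w_def)
  have w_\<Lambda>: "AE x in lborel. x \<in> {0..<1} \<longrightarrow> (\<forall>k\<in>words b q. w x * (\<Sum>l\<in>words b q. V x k l) \<le> \<Lambda> * w (xw b x k))"
    using \<Lambda>(3)
  proof eventually_elim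
    case (elim x)
    then show ?case using w_eq xw_in_unit[OF b_pos] by metis
  qed
  have w_W: "AE x in lborel. x \<in> {0..<1} \<longrightarrow> w x \<le> W"
    using W(2) by eventually_elim (auto simp: w_eq)
  obtain K r where K: "K \<ge> 0" and r: "\<And>n. r n > 0" "r \<longlonglongrightarrow> 0"
      and J: "\<And>n. weighted_energy w (r n) \<le> ennreal (K * (r n)\<^sup>2)"
    by (rule energy_bound[OF w_meas w_nonneg V E \<epsilon>\<delta> q(1) \<Lambda>(1) w_\<Lambda> \<Lambda>(2) less_imp_le[OF W(1)] w_W]) blast+
  have "(\<integral>\<^sup>+x. energy (r n) x * indicator {0..<1} x \<partial>lborel) \<le> ennreal (W' * K * (r n)\<^sup>2)" for n
  proof -
    have "(\<integral>\<^sup>+x. energy (r n) x * indicator {0..<1} x \<partial>lborel)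
        \<le> (\<integral>\<^sup>+x. ennreal W' * (ennreal (w x) * energy (r n) x * indicator {0..<1} x) \<partial>lborel)"
    proof (rule nn_integral_mono_AE)
      show "AE x in lborel. energy (r n) x * indicator {0..<1} x \<le> ennreal W' * (ennreal (w x) * energy (r n) x * indicator {0..<1} x)"
        using W'(2)
      proof eventually_elim
        case (elim x)
        show ?case
        proof (cases "x \<in> {0..<1}")
          case True
          then have "1 \<le> W' * w x"
            using elim \<omega>_pos[OF True] by (simp add: w_eq field_simps)
          then have "1 \<le> ennreal W' * ennreal (w x)"
            using W'(1) w_nonneg[OF True] by (simp add: ennreal_mult[symmetric])
          then have "1 * energy (r n) x \<le> (ennreal W' * ennreal (w x)) * energy (r n) x"
            by (rule mult_right_mono) simp
          then show ?thesis using True by (simp add: mult.assoc)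
        qed simp
      qed
    qed
    also have "\<dots> = ennreal W' * weighted_energy w (r n)"
      unfolding weighted_energy_def by (rule nn_integral_cmult) measurable
    also have "\<dots> \<le> ennreal W' * ennreal (K * (r n)\<^sup>2)"
      by (intro mult_left_mono J) simp
    also have "\<dots> = ennreal (W' * K * (r n)\<^sup>2)"
      using W'(1) K by (simp add: ennreal_mult[symmetric] mult.assoc)
    finally show ?thesis .
  qed
  with K W'(1) r that[of "W' * K" r] show ?thesis by simp
qed

theorem theorem2p2:
  fixes b :: nat and \<gamma> :: real and \<psi> \<psi>' :: "real \<Rightarrow> real"
  assumes b: "b \<ge> 2"
    and \<gamma>: "1 / real b < \<gamma>" "\<gamma> < 1"
    and \<psi>_deriv: "\<And>x. (\<psi> has_real_derivative \<psi>' x) (at x)"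
    and \<psi>'_cont: "continuous_on UNIV \<psi>'"
    and \<psi>_per: "\<And>x. \<psi> (x + 1) = \<psi> x"
    and q: "q \<ge> 1" "sigma b \<gamma> \<psi> q < ereal ((\<gamma> * real b) ^ q)"
  shows "(\<exists>f :: real \<times> real \<Rightarrow> real. f \<in> borel_measurable borel \<and> (\<forall>z. f z \<ge> 0) \<and>
            (\<integral>\<^sup>+ z \<in> {0..<1} \<times> UNIV. ennreal ((f z)\<^sup>2) \<partial>lborel) < \<infinity> \<and>
            (\<forall>B \<in> sets borel. B \<subseteq> {0..<1} \<times> UNIV \<longrightarrow>
               vartheta b \<gamma> \<psi> B = (\<integral>\<^sup>+ z \<in> B. ennreal (f z) \<partial>lborel)))
       \<and> (AE x in lborel. x \<in> {0..<1} \<longrightarrow>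
            (\<exists>g :: real \<Rightarrow> real. g \<in> borel_measurable borel \<and> (\<forall>y. g y \<ge> 0) \<and>
               (\<integral>\<^sup>+ y. ennreal ((g y)\<^sup>2) \<partial>lborel) < \<infinity> \<and>
               (\<forall>A \<in> sets borel. emeasure (mx b \<gamma> \<psi> x) A = (\<integral>\<^sup>+ y \<in> A. ennreal (g y) \<partial>lborel))))"
proof -
  interpret skew_product b \<gamma> \<psi> \<psi>'
    by unfold_locales (fact b \<gamma> \<psi>_deriv \<psi>'_cont \<psi>_per)+
  obtain K r where K: "K \<ge> 0" and r: "\<And>n. r n > 0" "r \<longlonglongrightarrow> 0"
    and energy: "\<And>n. (\<integral>\<^sup>+x. energy (r n) x * indicator {0..<1} x \<partial>lborel) \<le> ennreal (K * (r n)\<^sup>2)"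
    using energy_of_sigma[OF q] by blast
  obtain f :: "real \<times> real \<Rightarrow> real" where f: "f \<in> borel_measurable borel" "\<And>z. f z \<ge> 0"
    "\<Theta> = density lborel (\<lambda>z. ennreal (f z))" "(\<integral>\<^sup>+z. ennreal ((f z)\<^sup>2) \<partial>lborel) \<le> ennreal (K / 4)"
  proof (rule square_integrable_density[OF finite_\<Theta> sets_\<Theta>, of "ennreal (K / 4)"])
    show "2 * (\<integral>\<^sup>+z. (\<Sum>c\<in>I. c * indicator (U c) z) \<partial>\<Theta>)
      \<le> (\<integral>\<^sup>+z. (\<Sum>c\<in>I. c * indicator (U c) z)\<^sup>2 \<partial>lborel) + ennreal (K / 4)"
      if "finite I" "\<And>c. c \<in> I \<Longrightarrow> c < top" "\<And>c. c \<in> I \<Longrightarrow> open (U c)" for I and U :: "ennreal \<Rightarrow> (real \<times> real) set"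
      by (rule \<Theta>_open_ineq[OF r K energy that(1,3)])
  qed auto
  note f(1)[measurable]
  have f_sq: "(\<integral>\<^sup>+z. ennreal ((f z)\<^sup>2) \<partial>lborel) < \<infinity>"
    using f(4) by (rule le_less_trans) simp
  have "(\<integral>\<^sup>+ z \<in> {0..<1} \<times> UNIV. ennreal ((f z)\<^sup>2) \<partial>lborel) \<le> (\<integral>\<^sup>+z. ennreal ((f z)\<^sup>2) \<partial>lborel)"
    by (intro nn_integral_mono) (auto simp: indicator_def)
  then have "(\<integral>\<^sup>+ z \<in> {0..<1} \<times> UNIV. ennreal ((f z)\<^sup>2) \<partial>lborel) < \<infinity>"
    using f_sq by (rule le_less_trans)
  moreover have "vartheta b \<gamma> \<psi> B = (\<integral>\<^sup>+ z \<in> B. ennreal (f z) \<partial>lborel)" if "B \<in> sets borel" for B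
    unfolding vartheta_eq_\<Theta>[OF that] f(3) using that by (intro emeasure_density) auto
  moreover have "AE x in lborel. x \<in> {0..<1} \<longrightarrow>
            (\<exists>g :: real \<Rightarrow> real. g \<in> borel_measurable borel \<and> (\<forall>y. g y \<ge> 0) \<and>
               (\<integral>\<^sup>+ y. ennreal ((g y)\<^sup>2) \<partial>lborel) < \<infinity> \<and>
               (\<forall>A \<in> sets borel. emeasure (mx b \<gamma> \<psi> x) A = (\<integral>\<^sup>+ y \<in> A. ennreal (g y) \<partial>lborel)))"
  proof -
    have [measurable]: "f \<in> borel_measurable (borel \<Otimes>\<^sub>M borel)"
      using f(1) by (simp add: borel_prod)
    \<comment> \<open>By Tonelli, almost every fibre of \<open>f\<close> is square integrable; those
      fibres are the densities of the measures \<open>mx\<close>.\<close>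
    have "(\<integral>\<^sup>+x. \<integral>\<^sup>+y. ennreal ((f (x, y))\<^sup>2) \<partial>lborel \<partial>lborel) = (\<integral>\<^sup>+z. ennreal ((f z)\<^sup>2) \<partial>(lborel \<Otimes>\<^sub>M lborel))"
      by (rule lborel.nn_integral_fst) measurable
    then have "(\<integral>\<^sup>+x. \<integral>\<^sup>+y. ennreal ((f (x, y))\<^sup>2) \<partial>lborel \<partial>lborel) \<noteq> \<infinity>"
      using f_sq by (simp add: lborel_prod)
    then have "AE x in lborel. (\<integral>\<^sup>+y. ennreal ((f (x, y))\<^sup>2) \<partial>lborel) \<noteq> \<infinity>"
      by (rule nn_integral_PInf_AE[rotated]) measurable
    then show ?thesis
      using fibre_densities[OF f(1,3)]
    proof eventually_elim
      case (elim x)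
      show ?case
      proof
        assume "x \<in> {0..<1}"
        then have mx: "mx b \<gamma> \<psi> x = density lborel (\<lambda>y. ennreal (f (x, y)))" using elim by blast
        have "emeasure (mx b \<gamma> \<psi> x) A = (\<integral>\<^sup>+ y \<in> A. ennreal (f (x, y)) \<partial>lborel)" if "A \<in> sets borel" for A
          unfolding mx using that by (intro emeasure_density) auto
        moreover have "(\<lambda>y. f (x, y)) \<in> borel_measurable borel" by measurable
        moreover have "(\<integral>\<^sup>+y. ennreal ((f (x, y))\<^sup>2) \<partial>lborel) < \<infinity>"
          using elim(1) by (simp add: less_top)
        ultimately show "\<exists>g :: real \<Rightarrow> real. g \<in> borel_measurable borel \<and> (\<forall>y. g y \<ge> 0) \<and>
               (\<integral>\<^sup>+ y. ennreal ((g y)\<^sup>2) \<partial>lborel) < \<infinity> \<and>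
               (\<forall>A \<in> sets borel. emeasure (mx b \<gamma> \<psi> x) A = (\<integral>\<^sup>+ y \<in> A. ennreal (g y) \<partial>lborel))"
          using f(2) by (intro exI[of _ "\<lambda>y. f (x, y)"]) auto
      qed
    qed
  qed
  ultimately show ?thesis using f(1,2) by blast
qed

end
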